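(* Let $K$ be a field and $S=K[x_1,x_2,x_3]$. If $I\subseteq S$ is a monomial ideal with $0\neq I\neq S$, then $\operatorname{sdepth}(I)>\operatorname{sdepth}(S/I)$.
   Context: Stanley depth. Let $K$ be a field, $S=K[x_1,\dots,x_n]$ with its standard $\mathbb{Z}^n$-grading, and let $M$ be a nonzero $\mathbb{Z}^n$-graded $S$-module (here $n=3$ and $M=I$ or $M=S/I$ for a monomial ideal $I$). For a homogeneous element $m\in M$ and a subset $Z\subseteq\{x_1,\dots,x_n\}$, the $K[Z]$-submodule $mK[Z]$ of $M$ is called a Stanley space of dimension $|Z|$ if it is a free $K[Z]$-module. A Stanley decomposition $\mathcal{D}$ of $M$ is a finite direct sum decomposition $M=\bigoplus_{j=1}^r m_jK[Z_j]$ of $M$ as a $\mathbb{Z}^n$-graded $K$-vector space in which each $m_jK[Z_j]$ is a Stanley space of $M$. Put $\operatorname{sdepth}(\mathcal{D})=\min_j|Z_j|$, and let $\operatorname{sdepth}(M)$ be the maximum of $\operatorname{sdepth}(\mathcal{D})$ over all Stanley decompositions $\mathcal{D}$ of $M$. *)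

theory Defs
  imports
    "HOL-Library.Poly_Mapping"
    "HOL-Library.Numeral_Type"
    "HOL-Algebra.QuotRing"
    "HOL-Algebra.Module"
    "HOL-Algebra.Algebraic_Closure_Type"
begin

text \<open>
  Polynomials over \<^typ>\<open>'k\<close> in the variables \<open>x\<^sub>i\<close>, \<open>i :: 'n\<close>: a finitely supported
  function on exponent vectors. The type \<^typ>\<open>'n\<close> is meant to be finite, so that
  \<open>CARD('n)\<close> is the number of variables.
\<close>

type_synonym ('n, 'k) mpoly = "('n \<Rightarrow>\<^sub>0 nat) \<Rightarrow>\<^sub>0 'k"

abbreviation mpoly_ring :: "('n, 'k::field) mpoly ring" where
  "mpoly_ring \<equiv> ring_of_type_algebra"

definition homogeneous_polys :: "('n \<Rightarrow> int) \<Rightarrow> ('n, 'k::field) mpoly set" where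
  "homogeneous_polys a = {f. \<forall>t \<in> Poly_Mapping.keys f. \<forall>i. int (Poly_Mapping.lookup t i) = a i}"

text \<open>The subring \<open>K[Z]\<close>; a set of variables is given by the set of their indices.\<close>

definition polys_in :: "'n set \<Rightarrow> ('n, 'k::field) mpoly set" where
  "polys_in Z = {f. \<forall>t \<in> Poly_Mapping.keys f. Poly_Mapping.keys t \<subseteq> Z}"

definition monomials :: "('n, 'k::field) mpoly set" where
  "monomials = range (\<lambda>t. Poly_Mapping.single t 1)"

definition monomial_ideal :: "('n, 'k::field) mpoly set \<Rightarrow> bool" where
  "monomial_ideal I \<longleftrightarrow> (\<exists>G \<subseteq> monomials. I = Idl\<^bsub>mpoly_ring\<^esub> G)"

text \<open>
  The \<^const>\<open>monoid.mult\<close> and \<^const>\<open>monoid.one\<close> fields of a \<^typ>\<open>('r, 'm) module\<close> record play no role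
  in the notion of a module.
\<close>

definition ideal_module :: "('n, 'k::field) mpoly set \<Rightarrow> (('n, 'k) mpoly, ('n, 'k) mpoly) module" where
  "ideal_module I = \<lparr>carrier = I, monoid.mult = (*), one = 1, zero = 0, add = (+), module.smult = (*)\<rparr>"

definition quotient_module :: "('n, 'k::field) mpoly set \<Rightarrow> (('n, 'k) mpoly, ('n, 'k) mpoly set) module" where
  "quotient_module I = (let Q = mpoly_ring Quot I in
     \<lparr>carrier = carrier Q, monoid.mult = monoid.mult Q, one = one Q, zero = zero Q, add = add Q,
      module.smult = (\<lambda>f C. (I +>\<^bsub>mpoly_ring\<^esub> f) \<otimes>\<^bsub>Q\<^esub> C)\<rparr>)"

text \<open>
  A grading of a module is given by its homogeneous components, indexed by degrees
  in \<open>\<int>\<^sup>n\<close>. Both gradings below are induced by the standard one of the polynomial ring.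
\<close>

definition ideal_grading :: "('n, 'k::field) mpoly set \<Rightarrow> ('n \<Rightarrow> int) \<Rightarrow> ('n, 'k) mpoly set" where
  "ideal_grading I a = I \<inter> homogeneous_polys a"

definition quotient_grading :: "('n, 'k::field) mpoly set \<Rightarrow> ('n \<Rightarrow> int) \<Rightarrow> ('n, 'k) mpoly set set" where
  "quotient_grading I a = (\<lambda>f. I +>\<^bsub>mpoly_ring\<^esub> f) ` homogeneous_polys a"

definition cyclic_submodule ::
    "(('n, 'k::field) mpoly, 'm) module \<Rightarrow> 'm \<Rightarrow> 'n set \<Rightarrow> 'm set" where
  "cyclic_submodule M m Z = {f \<odot>\<^bsub>M\<^esub> m | f. f \<in> polys_in Z}"

text \<open>
  Freeness of a submodule \<open>N\<close> of \<open>M\<close>, with scalars restricted to the subring \<open>A\<close>: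
  there is a basis \<open>B\<close>, i.e. each element of \<open>N\<close> is a unique finite \<open>A\<close>-linear
  combination of elements of \<open>B\<close>. In particular the zero module is free.
\<close>

definition free_over ::
    "('n, 'k::field) mpoly set \<Rightarrow> (('n, 'k) mpoly, 'm) module \<Rightarrow> 'm set \<Rightarrow> bool" where
  "free_over A M N \<longleftrightarrow>
     (\<exists>B \<subseteq> N. \<forall>x \<in> N. \<exists>!c :: 'm \<Rightarrow> ('n, 'k) mpoly.
        range c \<subseteq> A \<and> finite {b. c b \<noteq> 0} \<and> {b. c b \<noteq> 0} \<subseteq> B \<and>
        x = (\<Oplus>\<^bsub>M\<^esub>b \<in> {b. c b \<noteq> 0}. c b \<odot>\<^bsub>M\<^esub> b))"

definition stanley_space ::
    "(('n, 'k::field) mpoly, 'm) module \<Rightarrow> (('n \<Rightarrow> int) \<Rightarrow> 'm set) \<Rightarrow> 'm \<Rightarrow> 'n set \<Rightarrow> bool" where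
  "stanley_space M G m Z \<longleftrightarrow>
     m \<in> carrier M \<and> (\<exists>a. m \<in> G a) \<and> free_over (polys_in Z) M (cyclic_submodule M m Z)"

text \<open>
  The list consists of the pairs \<open>(m\<^sub>j, Z\<^sub>j)\<close>. Every summand is a graded \<open>K\<close>-subspace, as
  \<open>m\<^sub>j\<close> is homogeneous and \<open>K \<subseteq> K[Z\<^sub>j]\<close>; so a direct sum decomposition of the additive
  group is one of graded vector spaces.
\<close>

definition stanley_decomposition ::
    "(('n, 'k::field) mpoly, 'm) module \<Rightarrow> (('n \<Rightarrow> int) \<Rightarrow> 'm set) \<Rightarrow> ('m \<times> 'n set) list \<Rightarrow> bool" where
  "stanley_decomposition M G D \<longleftrightarrow>
     (\<forall>(m, Z) \<in> set D. stanley_space M G m Z) \<and>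
     (\<forall>x \<in> carrier M.
        \<exists>!y. y \<in> (\<Pi>\<^sub>E j \<in> {..<length D}. cyclic_submodule M (fst (D ! j)) (snd (D ! j))) \<and>
             x = (\<Oplus>\<^bsub>M\<^esub>j \<in> {..<length D}. y j))"

definition sdepth_decomposition :: "('m \<times> 'n set) list \<Rightarrow> nat" where
  "sdepth_decomposition D = Min (card ` snd ` set D)"

text \<open>
  For a nonzero module over finitely many variables, all decompositions are nonempty lists,
  so the minimum exists and is at most the number of variables.
\<close>

definition sdepth ::
    "(('n, 'k::field) mpoly, 'm) module \<Rightarrow> (('n \<Rightarrow> int) \<Rightarrow> 'm set) \<Rightarrow> nat" where
  "sdepth M G = Max (sdepth_decomposition ` {D. stanley_decomposition M G D})"

lemma mpoly_ring_simps [simp]: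
  "carrier mpoly_ring = UNIV" "monoid.mult mpoly_ring = (*)" "one mpoly_ring = 1"
  "zero mpoly_ring = 0" "add mpoly_ring = (+)"
  by (simp_all add: ring_of_type_algebra_def)

lemma ideal_monomial_ideal: "monomial_ideal I \<Longrightarrow> ideal I mpoly_ring"
  by (auto simp: monomial_ideal_def intro!: ring.genideal_ideal)

lemma module_ideal_module:
  assumes "ideal I mpoly_ring"
  shows "module mpoly_ring (ideal_module I)"
proof -
  interpret ideal I mpoly_ring by fact
  have neg: "- x \<in> I" if "x \<in> I" for x
    using I_l_closed[OF that, of "- 1"] by simp
  have cl: "0 \<in> I" "\<And>x y. x \<in> I \<Longrightarrow> y \<in> I \<Longrightarrow> x + y \<in> I"
    "\<And>f x. x \<in> I \<Longrightarrow> f * x \<in> I"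
    using additive_subgroup.zero_closed[OF additive_subgroup_axioms]
      additive_subgroup.a_closed[OF additive_subgroup_axioms] I_l_closed by auto
  show ?thesis
  proof (rule moduleI)
    show "abelian_group (ideal_module I)"
      by (rule abelian_groupI)
        (auto simp: ideal_module_def algebra_simps cl intro: bexI[OF _ neg])
  qed (auto simp: ideal_module_def algebra_simps cl)
qed

lemma module_quotient_module:
  assumes "ideal I mpoly_ring"
  shows "module mpoly_ring (quotient_module I)"
proof -
  interpret ideal I mpoly_ring by fact
  interpret S: cring mpoly_ring ..
  let ?Q = "mpoly_ring Quot I"
  interpret Q: cring ?Q by (rule quotient_is_cring) (rule S.is_cring)
  interpret h: ring_hom_ring mpoly_ring ?Q "(+>\<^bsub>mpoly_ring\<^esub>) I"
    by (rule rcos_ring_hom_ring)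
  have hom: "I +>\<^bsub>mpoly_ring\<^esub> f \<in> carrier ?Q"
    "I +>\<^bsub>mpoly_ring\<^esub> (f + g) = (I +>\<^bsub>mpoly_ring\<^esub> f) \<oplus>\<^bsub>?Q\<^esub> (I +>\<^bsub>mpoly_ring\<^esub> g)"
    "I +>\<^bsub>mpoly_ring\<^esub> (f * g) = (I +>\<^bsub>mpoly_ring\<^esub> f) \<otimes>\<^bsub>?Q\<^esub> (I +>\<^bsub>mpoly_ring\<^esub> g)"
    "I +>\<^bsub>mpoly_ring\<^esub> 1 = \<one>\<^bsub>?Q\<^esub>" for f g
    using h.hom_closed[of f] h.hom_add[of f g] h.hom_mult[of f g] h.hom_one by auto
  show ?thesis
  proof (rule moduleI)
    show "abelian_group (quotient_module I)"
      by (rule abelian_groupI)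
        (auto simp: quotient_module_def Let_def Q.a_ac intro: Q.l_neg bexI[of _ "\<ominus>\<^bsub>?Q\<^esub> _"])
  qed (auto simp: quotient_module_def Let_def hom Q.l_distr Q.r_distr Q.m_assoc
        intro: S.is_cring)
qed

end

theory Submission
  imports Defs "HOL-Library.Product_Order" "HOL-Library.Disjoint_Sets"
begin

text \<open>
  A monomial ideal \<open>I\<close> of \<open>S = K[x\<^sub>1, x\<^sub>2, x\<^sub>3]\<close> is described by the up-closed set \<open>E \<subseteq> \<nat>\<^sup>3\<close> of the
  exponents of its monomials, and \<open>S/I\<close> by the complement of \<open>E\<close>. The space \<open>x\<^sup>tK[Z]\<close> corresponds to
  the box \<open>t + \<nat>\<^sup>Z\<close>, so a partition of \<open>E\<close> or of its complement into finitely many boxes is a Stanley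
  decomposition of \<open>I\<close> or of \<open>S/I\<close> (\<open>stanley_decomposition_of_boxes\<close>).

  Let \<open>d\<close> be the Stanley depth of \<open>S/I\<close>. A decomposition that attains it, with whatever
  homogeneous generators, has a combinatorial consequence: every \<open>t\<close> outside \<open>E\<close> is the corner of a box of
  dimension at least \<open>d\<close> that is disjoint from \<open>E\<close> (\<open>stanley_quotient_box\<close>). Indeed \<open>x\<^sup>t\<close> occurs in
  some summand \<open>mK[Z]\<close>, and as this summand is free, no monomial in the variables of \<open>Z\<close> can
  multiply \<open>x\<^sup>t\<close> into \<open>I\<close>.

  It remains to deduce from this that \<open>E\<close> has a partition into boxes of dimension at least
  \<open>d + 1\<close> (\<open>upset_decomposes\<close>). The case \<open>d = 3\<close> cannot occur as \<open>I \<noteq> 0\<close>. If \<open>d = 2\<close>, then \<open>I\<close> is principal and \<open>E\<close> is one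
  box of dimension three (\<open>upset_is_principal\<close>). For \<open>d \<le> 1\<close>, cut \<open>E\<close> into its plane slices
  \<open>E\<^sub>0 \<subseteq> E\<^sub>1 \<subseteq> \<dots>\<close>, which become stationary by Dickson's lemma. Then \<open>E\<close> is the disjoint
  union of the sets \<open>{c..} \<times> (E\<^sub>c - E\<^sub>c\<^sub>-\<^sub>1)\<close>, and one dimension is gained from the ray \<open>{c..}\<close>
  (\<open>decomposes_by_increments\<close>). So it suffices to divide the increments into boxes of dimension at least \<open>d\<close>. For
  \<open>d = 0\<close> this is possible for any difference of up-closed sets. For \<open>d = 1\<close>, a point of the
  increment at \<open>c\<close> lies outside \<open>E\<close> at level \<open>c - 1\<close>, and a ray from there avoids \<open>E\<close>; it does
  not have the direction of the first coordinate, since one step in this direction leads into \<open>E\<close>. A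
  plane increment with a ray of this kind at every point consists of finitely many
  disjoint rays (\<open>decomposes_diff_rays\<close>).

  Slicing also shows that the complement of \<open>E\<close> has some partition into boxes
  (\<open>complement_decomposes\<close>), so \<open>S/I\<close> has a Stanley decomposition and its depth is attained.
\<close>

section \<open>Partitions into boxes\<close>

definition upset :: "'a::preorder set \<Rightarrow> bool" where
  "upset U \<longleftrightarrow> (\<forall>x \<in> U. \<forall>y. x \<le> y \<longrightarrow> y \<in> U)"

text \<open>
  The first argument is the dimension. Boxes in higher dimension are iterated
  products of these two kinds of sets; \<open>prod_box (prod_box axis_box)\<close> are the translated
  coordinate cones of \<open>\<nat>\<^sup>3\<close>.
\<close>

inductive axis_box :: "nat \<Rightarrow> nat set \<Rightarrow> bool" where
  point: "axis_box 0 {a}"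
| ray: "axis_box 1 {a..}"

inductive prod_box :: "(nat \<Rightarrow> 'a set \<Rightarrow> bool) \<Rightarrow> nat \<Rightarrow> (nat \<times> 'a) set \<Rightarrow> bool"
  for B where
  "axis_box i P \<Longrightarrow> B j Q \<Longrightarrow> prod_box B (i + j) (P \<times> Q)"

definition decomposes :: "(nat \<Rightarrow> 'a set \<Rightarrow> bool) \<Rightarrow> nat \<Rightarrow> 'a set \<Rightarrow> bool" where
  "decomposes B k S \<longleftrightarrow>
     (\<exists>F. finite F \<and> disjoint F \<and> \<Union>F = S \<and> (\<forall>Y \<in> F. \<exists>d \<ge> k. B d Y))"

lemma upsetD: "upset U \<Longrightarrow> x \<in> U \<Longrightarrow> x \<le> y \<Longrightarrow> y \<in> U"
  by (auto simp: upset_def)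

lemma decomposes_empty [simp]: "decomposes B k {}"
  unfolding decomposes_def by (rule exI[of _ "{}"]) auto

lemma decomposes_box: "B d S \<Longrightarrow> k \<le> d \<Longrightarrow> decomposes B k S"
  unfolding decomposes_def by (rule exI[of _ "{S}"]) auto

lemma decomposes_mono:
  assumes "decomposes B k S" "l \<le> k"
  shows "decomposes B l S"
proof -
  obtain F where F: "finite F" "disjoint F" "\<Union>F = S" "\<forall>Y \<in> F. \<exists>d \<ge> k. B d Y"
    using assms(1) unfolding decomposes_def by blast
  then have "\<forall>Y \<in> F. \<exists>d \<ge> l. B d Y" using assms(2) by (meson order_trans)
  then show ?thesis unfolding decomposes_def using F by blast
qed

lemma decomposes_UN:
  assumes "finite A" "disjoint_family_on S A" "\<And>a. a \<in> A \<Longrightarrow> decomposes B k (S a)"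
  shows "decomposes B k (\<Union>a\<in>A. S a)"
proof -
  have "\<forall>a\<in>A. \<exists>F. finite F \<and> disjoint F \<and> \<Union>F = S a \<and> (\<forall>Y \<in> F. \<exists>d \<ge> k. B d Y)"
    using assms(3) unfolding decomposes_def by blast
  then obtain F where F: "\<And>a. a \<in> A \<Longrightarrow> finite (F a)" "\<And>a. a \<in> A \<Longrightarrow> disjoint (F a)"
    "\<And>a. a \<in> A \<Longrightarrow> \<Union>(F a) = S a" "\<And>a Y. a \<in> A \<Longrightarrow> Y \<in> F a \<Longrightarrow> \<exists>d \<ge> k. B d Y"
    by metis
  have "disjoint (\<Union>a\<in>A. F a)"
  proof (rule disjointI, clarify)
    fix Y Z a b assume *: "Y \<noteq> Z" "Y \<in> F a" "Z \<in> F b" "a \<in> A" "b \<in> A"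
    show "Y \<inter> Z = {}"
    proof (cases "a = b")
      case True
      then show ?thesis using F(2)[of a] * by (auto dest: disjointD)
    next
      case False
      then have "S a \<inter> S b = {}" using assms(2) * by (auto simp: disjoint_family_on_def)
      then show ?thesis using F(3) * by blast
    qed
  qed
  moreover have "\<Union>(\<Union>a\<in>A. F a) = (\<Union>a\<in>A. S a)" by (auto simp flip: F(3))
  ultimately show ?thesis
    unfolding decomposes_def using F(1,4) assms(1)
    by (intro exI[of _ "\<Union>a\<in>A. F a"]) auto
qed

lemma decomposes_Un:
  assumes "decomposes B k S" "decomposes B k Y" "S \<inter> Y = {}"
  shows "decomposes B k (S \<union> Y)"
proof -
  have "decomposes B k (\<Union>b\<in>{True, False}. if b then S else Y)"
    by (rule decomposes_UN) (use assms in \<open>auto simp: disjoint_family_on_def\<close>)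
  then show ?thesis by (simp add: Un_commute)
qed

lemma decomposes_map:
  assumes "decomposes B k S" "inj_on f S"
    "\<And>d Y. B d Y \<Longrightarrow> Y \<subseteq> S \<Longrightarrow> C d (f ` Y)"
  shows "decomposes C k (f ` S)"
proof -
  obtain F where F: "finite F" "disjoint F" "\<Union>F = S" "\<forall>Y \<in> F. \<exists>d \<ge> k. B d Y"
    using assms(1) unfolding decomposes_def by blast
  have "disjoint ((`) f ` F)"
  proof (rule disjointI, clarify)
    fix Y Z assume *: "f ` Y \<noteq> f ` Z" "Y \<in> F" "Z \<in> F"
    then have "Y \<inter> Z = {}" using F(2) by (auto dest: disjointD)
    then show "f ` Y \<inter> f ` Z = {}"
      using inj_on_image_Int[OF assms(2), of Y Z] * F(3) by auto
  qed
  moreover have "\<forall>Y \<in> (`) f ` F. \<exists>d \<ge> k. C d Y"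
  proof clarify
    fix Y assume "Y \<in> F"
    then obtain d where "d \<ge> k" "B d Y" "Y \<subseteq> S" using F(3,4) by auto
    then show "\<exists>d \<ge> k. C d (f ` Y)" using assms(3) by (intro exI[of _ d]) simp
  qed
  moreover have "\<Union>((`) f ` F) = f ` S" using F(3) by auto
  ultimately show ?thesis
    unfolding decomposes_def using F(1) by blast
qed

text \<open>
  Multiplying all parts by an interval of the new coordinate adds its dimension to
  each of them. This is how a partition of a slice becomes one of a slab.
\<close>

lemma decomposes_Times:
  assumes "axis_box i P" "decomposes B k S"
  shows "decomposes (prod_box B) (i + k) (P \<times> S)"
proof -
  obtain F where F: "finite F" "disjoint F" "\<Union>F = S" "\<forall>Y \<in> F. \<exists>d \<ge> k. B d Y"
    using assms(2) unfolding decomposes_def by blast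
  have "disjoint ((\<times>) P ` F)"
    using F(2) by (intro disjointI) (auto dest: disjointD)
  moreover have "\<forall>Y \<in> (\<times>) P ` F. \<exists>d \<ge> i + k. prod_box B d Y"
  proof clarify
    fix Y assume "Y \<in> F"
    then obtain d where "d \<ge> k" "B d Y" using F(4) by auto
    then show "\<exists>d \<ge> i + k. prod_box B d (P \<times> Y)"
      using prod_box.intros[of i P B d Y] assms(1) by (intro exI[of _ "i + d"]) simp
  qed
  moreover have "\<Union>((\<times>) P ` F) = P \<times> S" using F(3) by auto
  ultimately show ?thesis
    unfolding decomposes_def using F(1) by blast
qed

section \<open>Up-closed sets and their slices\<close>

text \<open>
  Dickson's lemma as a property of an ordered type: up-closed sets are finitely
  generated. Stated for a type, it can be passed from \<open>'a\<close> to \<open>nat \<times> 'a\<close>.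
\<close>

definition dickson :: "'a::preorder itself \<Rightarrow> bool" where
  "dickson _ \<longleftrightarrow>
     (\<forall>U :: 'a set. upset U \<longrightarrow> (\<exists>F. finite F \<and> F \<subseteq> U \<and> (\<forall>x \<in> U. \<exists>y \<in> F. y \<le> x)))"

definition slice :: "('b \<times> 'a) set \<Rightarrow> 'b \<Rightarrow> 'a set" where
  "slice E c = {x. (c, x) \<in> E}"

lemma upset_slice: "upset (E :: ('b::preorder \<times> 'a::preorder) set) \<Longrightarrow> upset (slice E c)"
  unfolding upset_def slice_def by auto

lemma slice_mono: "upset (E :: ('b::preorder \<times> 'a::preorder) set) \<Longrightarrow> c \<le> d \<Longrightarrow> slice E c \<subseteq> slice E d"
  unfolding slice_def by (auto elim!: upsetD)

text \<open>
  The slices increase, and each of the finitely many generators of their union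
  already occurs in some slice.
\<close>

lemma slices_stabilise:
  assumes "dickson TYPE('a::preorder)" "upset (E :: (nat \<times> 'a) set)"
  obtains N where "\<And>c. c \<ge> N \<Longrightarrow> slice E c = slice E N"
proof -
  have "upset (\<Union>c. slice E c)"
    using upset_slice[OF assms(2)] unfolding upset_def by blast
  then obtain F where F: "finite F" "F \<subseteq> (\<Union>c. slice E c)" "\<forall>x \<in> (\<Union>c. slice E c). \<exists>y \<in> F. y \<le> x"
    using assms(1) unfolding dickson_def by meson
  then have "\<forall>y\<in>F. \<exists>c. y \<in> slice E c" by auto
  then obtain h where h: "\<And>y. y \<in> F \<Longrightarrow> y \<in> slice E (h y)" by metis
  obtain N where N: "\<And>y. y \<in> F \<Longrightarrow> h y \<le> N"
    using finite_nat_set_iff_bounded_le[of "h ` F"] F(1) by auto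
  have "F \<subseteq> slice E N" using h N slice_mono[OF assms(2)] by blast
  then have "slice E c \<subseteq> slice E N" for c
    using F(3) upset_slice[OF assms(2), of N] by (fastforce simp: upset_def)
  then show ?thesis
    using that slice_mono[OF assms(2)] by blast
qed

lemma dickson_nat: "dickson TYPE(nat)"
  unfolding dickson_def
proof (intro allI impI)
  fix U :: "nat set"
  show "\<exists>F. finite F \<and> F \<subseteq> U \<and> (\<forall>x\<in>U. \<exists>y\<in>F. y \<le> x)"
  proof (cases "U = {}")
    case False
    then have "(LEAST x. x \<in> U) \<in> U" by (auto intro: LeastI)
    then show ?thesis
      by (intro exI[of _ "{LEAST x. x \<in> U}"]) (auto intro: Least_le)
  qed auto
qed

text \<open>
  Up to the level where the slices become constant there are finitely many slices, and the
  generators of these, placed in their levels, generate the whole set.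
\<close>

lemma dickson_prod:
  assumes "dickson TYPE('a::preorder)"
  shows "dickson TYPE(nat \<times> 'a)"
  unfolding dickson_def
proof (intro allI impI)
  fix U :: "(nat \<times> 'a) set" assume U: "upset U"
  obtain N where N: "\<And>c. c \<ge> N \<Longrightarrow> slice U c = slice U N"
    using slices_stabilise[OF assms U] by blast
  have "\<forall>c. \<exists>F. finite F \<and> F \<subseteq> slice U c \<and> (\<forall>x\<in>slice U c. \<exists>y\<in>F. y \<le> x)"
    using assms upset_slice[OF U] unfolding dickson_def by blast
  then obtain F where F: "\<And>c. finite (F c)" "\<And>c. F c \<subseteq> slice U c"
    "\<And>c x. x \<in> slice U c \<Longrightarrow> \<exists>y\<in>F c. y \<le> x" by metis
  have "\<exists>y\<in>Sigma {..N} F. y \<le> (c, x)" if "(c, x) \<in> U" for c x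
  proof -
    \<comment> \<open>Above \<open>N\<close> nothing new appears, so an element is dominated from its own level or from \<open>N\<close>.\<close>
    have "x \<in> slice U (min c N)"
      using that N[of c] by (cases "c \<le> N") (auto simp: slice_def min_def)
    then obtain y where "y \<in> F (min c N)" "y \<le> x" using F(3) by blast
    then show ?thesis by (intro bexI[of _ "(min c N, y)"]) auto
  qed
  moreover have "Sigma {..N} F \<subseteq> U" using F(2) unfolding slice_def by blast
  ultimately show "\<exists>F. finite F \<and> F \<subseteq> U \<and> (\<forall>x\<in>U. \<exists>y\<in>F. y \<le> x)"
    using F(1) by (intro exI[of _ "Sigma {..N} F"]) auto
qed

section \<open>Partitions of up-closed sets and their differences\<close>

lemma upset_nat: "upset U \<Longrightarrow> U = {} \<or> (\<exists>a::nat. U = {a..})"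
proof (cases "U = {}")
  case False
  assume U: "upset U"
  have "(LEAST x. x \<in> U) \<in> U" using False by (auto intro: LeastI)
  then have "U = {(LEAST x. x \<in> U)..}" using U by (auto intro: Least_le elim: upsetD)
  then show ?thesis by blast
qed auto

lemma decomposes_nat_finite:
  assumes "finite U" shows "decomposes axis_box 0 U"
proof -
  have "decomposes axis_box 0 (\<Union>a\<in>U. {a})"
    by (rule decomposes_UN) (use assms in \<open>auto simp: disjoint_family_on_def intro: decomposes_box axis_box.intros\<close>)
  then show ?thesis by simp
qed

lemma decomposes_nat_diff:
  assumes "upset U" "upset V" shows "decomposes axis_box 0 (V - U)"
proof (cases "U = {}")
  case True
  then show ?thesis using upset_nat[OF assms(2)] by (auto intro: decomposes_box axis_box.intros)
next
  case False
  then obtain a where "U = {a..}" using upset_nat[OF assms(1)] by blast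
  then have "finite (V - U)" by (auto intro!: finite_subset[of _ "{..<a}"])
  then show ?thesis by (rule decomposes_nat_finite)
qed

text \<open>
  Beyond some level \<open>N\<close> the slices of both sets are constant. Below \<open>N\<close> each slice of the
  difference is treated as a set of codimension one; from \<open>N\<close> on, all slices together form
  a single product with a ray.
\<close>

lemma decomposes_prod_diff:
  assumes wp: "dickson TYPE('a::preorder)"
    and diff: "\<And>U V :: 'a set. upset U \<Longrightarrow> upset V \<Longrightarrow> decomposes B 0 (V - U)"
    and U: "upset U" and V: "upset (V :: (nat \<times> 'a) set)"
  shows "decomposes (prod_box B) 0 (V - U)"
proof -
  obtain M where M: "\<And>c. c \<ge> M \<Longrightarrow> slice U c = slice U M"
    using slices_stabilise[OF wp U] by blast
  obtain M' where M': "\<And>c. c \<ge> M' \<Longrightarrow> slice V c = slice V M'"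
    using slices_stabilise[OF wp V] by blast
  define N where "N = max M M'"
  \<comment> \<open>The slabs below \<open>N\<close> have height one, the last one is infinite.\<close>
  define C where "C c = (if c = N then {N..} else {c})" for c
  define R where "R c = slice V c - slice U c" for c
  have R: "R c = R N" if "c \<ge> N" for c
    using M[of c] M[of N] M'[of c] M'[of N] that by (simp add: R_def N_def)
  have "decomposes (prod_box B) 0 (\<Union>c\<in>{..N}. C c \<times> R c)"
  proof (rule decomposes_UN)
    fix c
    obtain i where "axis_box i (C c)" unfolding C_def using axis_box.intros by metis
    moreover have "decomposes B 0 (R c)"
      unfolding R_def using diff upset_slice U V by blast
    ultimately have "decomposes (prod_box B) (i + 0) (C c \<times> R c)" by (rule decomposes_Times)
    then show "decomposes (prod_box B) 0 (C c \<times> R c)"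
      by (rule decomposes_mono) simp
  qed (auto simp: disjoint_family_on_def C_def)
  also have "(\<Union>c\<in>{..N}. C c \<times> R c) = V - U"
  proof -
    have "(c, x) \<in> (\<Union>c\<in>{..N}. C c \<times> R c) \<longleftrightarrow> x \<in> R c" for c x
      using R[of c] by (cases "c \<ge> N") (auto simp: C_def split: if_splits)
    then show ?thesis by (auto simp: R_def slice_def)
  qed
  finally show ?thesis .
qed

text \<open>
  The part of a slice that is new at level \<open>c\<close> stays in the set at all higher levels, so
  the set is the disjoint union of the products of \<open>{c..}\<close> with these increments. The extra
  ray raises every dimension by one; this is the source of the strict inequality
  between the Stanley depths.
\<close>

lemma decomposes_by_increments:
  assumes wp: "dickson TYPE('a::preorder)"
    and E: "upset (E :: (nat \<times> 'a) set)"
    and base: "decomposes B k (slice E 0)"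
    and step: "\<And>c. decomposes B k (slice E (Suc c) - slice E c)"
  shows "decomposes (prod_box B) (Suc k) E"
proof -
  obtain N where N: "\<And>c. c \<ge> N \<Longrightarrow> slice E c = slice E N"
    using slices_stabilise[OF wp E] by blast
  \<comment> \<open>For \<open>c > 0\<close> this is the difference of two consecutive slices; at level 0 it is the whole slice.\<close>
  define R where "R c = slice E c - (\<Union>b<c. slice E b)" for c
  have R: "R (Suc c) = slice E (Suc c) - slice E c" for c
    using slice_mono[OF E] by (force simp: R_def less_Suc_eq_le)
  have "decomposes (prod_box B) (Suc k) (\<Union>c\<in>{..N}. {c..} \<times> R c)"
  proof (rule decomposes_UN)
    fix c
    have "decomposes B k (R c)"
      using base step R by (cases c) (auto simp: R_def)
    then have "decomposes (prod_box B) (1 + k) ({c..} \<times> R c)"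
      using axis_box.ray decomposes_Times by blast
    then show "decomposes (prod_box B) (Suc k) ({c..} \<times> R c)" by simp
  next
    have "R c \<inter> R d = {}" if "c < d" for c d using that by (auto simp: R_def)
    then have "R c \<inter> R d = {}" if "c \<noteq> d" for c d using that by (metis Int_commute linorder_neqE_nat)
    then show "disjoint_family_on (\<lambda>c. {c..} \<times> R c) {..N}"
      by (auto simp: disjoint_family_on_def)
  qed simp
  also have "(\<Union>c\<in>{..N}. {c..} \<times> R c) = E"
  proof (intro equalityI subsetI)
    fix z assume "z \<in> (\<Union>c\<in>{..N}. {c..} \<times> R c)"
    then obtain b c x where "z = (c, x)" "b \<le> c" "x \<in> slice E b" by (auto simp: R_def)
    then show "z \<in> E" using slice_mono[OF E] by (auto simp: slice_def)
  next
    fix z assume "z \<in> E"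
    then obtain c x where z: "z = (c, x)" "x \<in> slice E c" by (cases z) (auto simp: slice_def)
    define b where "b = (LEAST b. x \<in> slice E b)"
    have b: "x \<in> slice E b" unfolding b_def using z(2) by (rule LeastI)
    have "b \<le> c" unfolding b_def using z(2) by (rule Least_le)
    moreover have "b \<le> N"
    proof (cases "c \<le> N")
      case False
      then have "x \<in> slice E N" using N[of c] z(2) by simp
      then show ?thesis unfolding b_def by (rule Least_le)
    qed (use \<open>b \<le> c\<close> in simp)
    moreover have "x \<in> R b" using b by (auto simp: R_def b_def dest: not_less_Least)
    ultimately show "z \<in> (\<Union>c\<in>{..N}. {c..} \<times> R c)" using z(1) by auto
  qed
  finally show ?thesis .
qed

text \<open>
  A set of finitely many rows that is closed under steps to the right is a union of
  finitely many horizontal rays, and likewise for columns.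
\<close>

lemma decomposes_rows_columns:
  assumes "\<And>b. b < \<beta> \<Longrightarrow> upset {a. (a, b) \<in> R}" "\<And>a b. (a, b) \<in> R \<Longrightarrow> b < \<beta>"
    and "\<And>a. a < \<alpha> \<Longrightarrow> upset {b. (a, b) \<in> C}" "\<And>a b. (a, b) \<in> C \<Longrightarrow> a < \<alpha>"
    and "R \<inter> C = {}"
  shows "decomposes (prod_box axis_box) 1 (R \<union> C)"
proof (rule decomposes_Un)
  have "decomposes (prod_box axis_box) 1 (\<Union>b\<in>{..<\<beta>}. {a. (a, b) \<in> R} \<times> {b})"
  proof (rule decomposes_UN)
    fix b assume "b \<in> {..<\<beta>}"
    then have "{a. (a, b) \<in> R} = {} \<or> (\<exists>m. {a. (a, b) \<in> R} = {m..})"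
      using assms(1) upset_nat by auto
    moreover have "prod_box axis_box (1 + 0) ({m..} \<times> {b})" for m
      by (intro prod_box.intros axis_box.intros)
    ultimately show "decomposes (prod_box axis_box) 1 ({a. (a, b) \<in> R} \<times> {b})"
      by (elim disjE exE) (simp_all add: decomposes_box[of _ 1])
  qed (auto simp: disjoint_family_on_def)
  moreover have "(\<Union>b\<in>{..<\<beta>}. {a. (a, b) \<in> R} \<times> {b}) = R" using assms(2) by auto
  ultimately show "decomposes (prod_box axis_box) 1 R" by simp
next
  have "decomposes (prod_box axis_box) 1 (\<Union>a\<in>{..<\<alpha>}. {a} \<times> {b. (a, b) \<in> C})"
  proof (rule decomposes_UN)
    fix a assume "a \<in> {..<\<alpha>}"
    then have "{b. (a, b) \<in> C} = {} \<or> (\<exists>m. {b. (a, b) \<in> C} = {m..})"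
      using assms(3) upset_nat by auto
    moreover have "prod_box axis_box (0 + 1) ({a} \<times> {m..})" for m
      by (intro prod_box.intros axis_box.intros)
    ultimately show "decomposes (prod_box axis_box) 1 ({a} \<times> {b. (a, b) \<in> C})"
      by (elim disjE exE) (simp_all add: decomposes_box[of _ 1])
  qed (auto simp: disjoint_family_on_def)
  moreover have "(\<Union>a\<in>{..<\<alpha>}. {a} \<times> {b. (a, b) \<in> C}) = C" using assms(4) by auto
  ultimately show "decomposes (prod_box axis_box) 1 C" by simp
qed fact

text \<open>
  Each point of the difference must be the start of a horizontal or a vertical ray
  that avoids \<open>U\<close>. The points whose whole row misses \<open>U\<close> fill rows below
  a point of \<open>U\<close>; for the remaining ones the column misses \<open>U\<close>, and they lie to the left
  of a point of \<open>U\<close>. So there are finitely many rows and columns, and they are closed under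
  the corresponding steps. Nonemptiness of \<open>U\<close> provides the point that bounds them.
\<close>

lemma decomposes_diff_rays:
  assumes U: "upset (U :: (nat \<times> nat) set)" and V: "upset V" and ne: "U \<noteq> {}"
    and esc: "\<And>a b. (a, b) \<in> V - U \<Longrightarrow> (\<forall>a' \<ge> a. (a', b) \<notin> U) \<or> (\<forall>b' \<ge> b. (a, b') \<notin> U)"
  shows "decomposes (prod_box axis_box) 1 (V - U)"
proof -
  obtain \<alpha> \<beta> where ab: "(\<alpha>, \<beta>) \<in> U" using ne by auto
  \<comment> \<open>Asking for the whole row instead of the ray to the right makes no difference, as \<open>U\<close> is up-closed.\<close>
  define R where "R = {(a, b) \<in> V. \<forall>a'. (a', b) \<notin> U}"
  define C where "C = V - U - R"
  have U': "(a', b') \<in> U" if "(a, b) \<in> U" "a \<le> a'" "b \<le> b'" for a b a' b'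
    using upsetD[OF U that(1)] that by auto
  have V': "(a', b') \<in> V" if "(a, b) \<in> V" "a \<le> a'" "b \<le> b'" for a b a' b'
    using upsetD[OF V that(1)] that by auto
  have C: "(a, b) \<in> C \<longleftrightarrow> (a, b) \<in> V \<and> (\<exists>a'. (a', b) \<in> U) \<and> (\<forall>b'. (a, b') \<notin> U)" (is "_ \<longleftrightarrow> ?rhs") for a b
  proof
    assume *: "(a, b) \<in> C"
    then obtain a' where a': "(a', b) \<in> U" by (auto simp: C_def R_def)
    have "(max a a', b) \<in> U" using U'[OF a'] by simp
    then have "\<forall>b' \<ge> b. (a, b') \<notin> U" using esc[of a b] * by (auto simp: C_def)
    moreover have "(a, b') \<notin> U" if "b' \<le> b" for b'
      using U'[of a b' a b] that * by (auto simp: C_def)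
    ultimately show ?rhs using a' * by (metis C_def DiffE linear)
  qed (auto simp: C_def R_def)
  have "decomposes (prod_box axis_box) 1 (R \<union> C)"
  proof (rule decomposes_rows_columns)
    show "upset {a. (a, b) \<in> R}" for b
      using V' by (auto simp: R_def upset_def)
    show "b < \<beta>" if "(a, b) \<in> R" for a b
      using U'[OF ab, of \<alpha> b] that by (force simp: R_def)
    show "upset {b. (a, b) \<in> C}" for a
      unfolding C upset_def using V'[of a _ a] U'[of _ _ _ _] by blast
    show "a < \<alpha>" if "(a, b) \<in> C" for a b
      using U'[OF ab, of a \<beta>] that unfolding C by force
  qed (auto simp: C_def)
  moreover have "R \<union> C = V - U" by (auto simp: C_def R_def)
  ultimately show ?thesis by simp
qed

text \<open>
  Remove one quadrant. Each remaining point is to the left of the quadrant or below it, so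
  one of the two rays from it avoids the quadrant.
\<close>

lemma decomposes_plane_upset:
  assumes "upset (V :: (nat \<times> nat) set)"
  shows "decomposes (prod_box axis_box) 1 V"
proof (cases "V = {}")
  case False
  then obtain a b where ab: "(a, b) \<in> V" by auto
  let ?Q = "{a..} \<times> {b..}"
  have "?Q \<subseteq> V" using upsetD[OF assms ab] by auto
  have "decomposes (prod_box axis_box) 1 (V - ?Q)"
    by (rule decomposes_diff_rays) (use assms in \<open>auto simp: upset_def\<close>)
  moreover have "decomposes (prod_box axis_box) 1 ?Q"
    using prod_box.intros[of 1 "{a..}" axis_box 1 "{b..}"]
    by (intro decomposes_box[of _ 2]) (use axis_box.ray in \<open>simp_all add: numeral_2_eq_2\<close>)
  ultimately have "decomposes (prod_box axis_box) 1 (V - ?Q \<union> ?Q)"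
    by (rule decomposes_Un) auto
  then show ?thesis using \<open>?Q \<subseteq> V\<close> by (simp add: Un_absorb2)
qed simp

lemma decomposes_space_diff:
  assumes "upset U" "upset (V :: (nat \<times> nat \<times> nat) set)"
  shows "decomposes (prod_box (prod_box axis_box)) 0 (V - U)"
  using assms
  by (intro decomposes_prod_diff dickson_prod dickson_nat decomposes_nat_diff)

lemma decomposes_space_upset_1:
  assumes "upset (E :: (nat \<times> nat \<times> nat) set)"
  shows "decomposes (prod_box (prod_box axis_box)) 1 E"
  unfolding One_nat_def
proof (rule decomposes_by_increments)
  have *: "decomposes (prod_box axis_box) 0 (V - U)" if "upset U" "upset V" for U V
    using that by (intro decomposes_prod_diff dickson_nat decomposes_nat_diff)
  show "decomposes (prod_box axis_box) 0 (slice E 0)"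
    using *[of "{}" "slice E 0"] upset_slice[OF assms] by (simp add: upset_def)
  show "decomposes (prod_box axis_box) 0 (slice E (Suc c) - slice E c)" for c
    using * upset_slice[OF assms] by blast
qed (use assms in \<open>auto intro: dickson_prod dickson_nat\<close>)

text \<open>
  A point \<open>(a, b)\<close> that is new at level \<open>c + 1\<close> is outside \<open>E\<close> at level \<open>c\<close>. Of the three rays
  starting there, the one in the first direction enters \<open>E\<close> with its first step, so the
  hypothesis gives a ray inside the plane that avoids the slice at level \<open>c\<close>. Hence all
  increments are unions of rays.
\<close>

lemma decomposes_space_upset_2:
  assumes E: "upset (E :: (nat \<times> nat \<times> nat) set)"
    and esc: "\<And>c a b. (c, a, b) \<notin> E \<Longrightarrow>
      (\<forall>c' \<ge> c. (c', a, b) \<notin> E) \<or> (\<forall>a' \<ge> a. (c, a', b) \<notin> E) \<or> (\<forall>b' \<ge> b. (c, a, b') \<notin> E)"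
  shows "decomposes (prod_box (prod_box axis_box)) 2 E"
  unfolding numeral_2_eq_2
proof (rule decomposes_by_increments)
  have *: "decomposes (prod_box axis_box) 1 (slice E c)" for c
    by (intro decomposes_plane_upset upset_slice E)
  show "decomposes (prod_box axis_box) (Suc 0) (slice E 0)" using * by simp
  show "decomposes (prod_box axis_box) (Suc 0) (slice E (Suc c) - slice E c)" for c
  proof (cases "slice E c = {}")
    case True
    then show ?thesis using * by simp
  next
    case False
    have "decomposes (prod_box axis_box) 1 (slice E (Suc c) - slice E c)"
    proof (rule decomposes_diff_rays)
      fix a b assume "(a, b) \<in> slice E (Suc c) - slice E c"
      then show "(\<forall>a'\<ge>a. (a', b) \<notin> slice E c) \<or> (\<forall>b'\<ge>b. (a, b') \<notin> slice E c)"
        using esc[of c a b] by (auto simp: slice_def)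
    qed (use False upset_slice[OF E] in auto)
    then show ?thesis by simp
  qed
qed (use E in \<open>auto intro: dickson_prod dickson_nat\<close>)

section \<open>Polynomials and sets of exponents\<close>

abbreviation xpow :: "('n \<Rightarrow>\<^sub>0 nat) \<Rightarrow> ('n, 'k::field) mpoly" where
  "xpow t \<equiv> Poly_Mapping.single t 1"

definition exponents :: "('n, 'k::field) mpoly set \<Rightarrow> ('n \<Rightarrow>\<^sub>0 nat) set" where
  "exponents I = {t. xpow t \<in> I}"

definition monomial_span :: "('n \<Rightarrow>\<^sub>0 nat) set \<Rightarrow> ('n, 'k::field) mpoly set" where
  "monomial_span S = {f. Poly_Mapping.keys f \<subseteq> S}"

definition monomial_box :: "('n \<Rightarrow>\<^sub>0 nat) \<Rightarrow> 'n set \<Rightarrow> ('n \<Rightarrow>\<^sub>0 nat) set" where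
  "monomial_box t Z = {t + w | w. Poly_Mapping.keys w \<subseteq> Z}"

definition dim_box :: "nat \<Rightarrow> ('n \<Rightarrow>\<^sub>0 nat) set \<Rightarrow> bool" where
  "dim_box d Y \<longleftrightarrow> (\<exists>t Z. Y = monomial_box t Z \<and> d = card Z)"

text \<open>
  The projection of polynomials onto those with all exponents in \<open>S\<close>.
\<close>

definition monomial_part :: "('n \<Rightarrow>\<^sub>0 nat) set \<Rightarrow> ('n, 'k::field) mpoly \<Rightarrow> ('n, 'k) mpoly" where
  "monomial_part S f = (\<Sum>t \<in> Poly_Mapping.keys f \<inter> S. Poly_Mapping.single t (Poly_Mapping.lookup f t))"

lemma lookup_monomial_part: "Poly_Mapping.lookup (monomial_part S f) t = (if t \<in> S then Poly_Mapping.lookup f t else 0)"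
proof -
  have "Poly_Mapping.lookup (monomial_part S f) t = (\<Sum>s \<in> Poly_Mapping.keys f \<inter> S. if s = t then Poly_Mapping.lookup f t else 0)"
    unfolding monomial_part_def lookup_sum by (intro sum.cong) (auto simp: lookup_single when_def)
  then show ?thesis by (simp add: in_keys_iff)
qed

lemma monomial_part_in_span: "monomial_part S f \<in> monomial_span S"
  by (auto simp: monomial_span_def in_keys_iff lookup_monomial_part split: if_splits)

lemma monomial_span_iff: "f \<in> monomial_span S \<longleftrightarrow> (\<forall>t. t \<notin> S \<longrightarrow> Poly_Mapping.lookup f t = 0)"
  by (auto simp: monomial_span_def in_keys_iff)

lemma mpoly_eq_sum: "(f :: ('n, 'k::field) mpoly) = (\<Sum>t \<in> Poly_Mapping.keys f. Poly_Mapping.single 0 (Poly_Mapping.lookup f t) * xpow t)"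
proof -
  have "f = monomial_part UNIV f"
    by (rule poly_mapping_eqI) (simp add: lookup_monomial_part)
  then show ?thesis by (simp add: monomial_part_def mult_single)
qed

lemma lookup_times_xpow: "Poly_Mapping.lookup (f * xpow t) s = (\<Sum>w \<in> Poly_Mapping.keys f. if w + t = s then Poly_Mapping.lookup f w else 0)"
proof -
  have "f * xpow t = (\<Sum>w \<in> Poly_Mapping.keys f. Poly_Mapping.single w (Poly_Mapping.lookup f w)) * xpow t"
    using mpoly_eq_sum[of f] by (simp add: mult_single)
  then show ?thesis
    by (simp add: sum_distrib_right mult_single lookup_sum lookup_single when_def)
qed

lemma lookup_times_xpow_add [simp]: "Poly_Mapping.lookup (f * xpow t) (w + t) = Poly_Mapping.lookup f w"
  by (simp add: lookup_times_xpow in_keys_iff)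

lemma lookup_times_xpow_0: "\<forall>w. w + t \<noteq> s \<Longrightarrow> Poly_Mapping.lookup (f * xpow t) s = 0"
  by (simp add: lookup_times_xpow)

lemma times_xpow_cancel: "f * xpow t = g * xpow t \<Longrightarrow> f = g"
  by (metis lookup_times_xpow_add poly_mapping_eqI)

text \<open>
  The polynomials of \<open>x\<^sup>tK[Z]\<close> are exactly those with exponents in \<open>t + \<nat>\<^sup>Z\<close>: this is the
  dictionary between Stanley spaces and boxes.
\<close>

lemma polys_in_times_xpow: "(\<lambda>f. f * xpow t) ` polys_in Z = monomial_span (monomial_box t Z)"
proof (intro equalityI subsetI)
  fix g assume "g \<in> (\<lambda>f. f * xpow t) ` polys_in Z"
  then obtain f where f: "g = f * xpow t" "f \<in> polys_in Z" by auto
  show "g \<in> monomial_span (monomial_box t Z)"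
    using keys_mult[of f "xpow t"] f
    by (fastforce simp: monomial_span_def monomial_box_def polys_in_def add.commute)
next
  fix g :: "('a, 'b) mpoly" assume g: "g \<in> monomial_span (monomial_box t Z)"
  have inj: "inj (\<lambda>w. w + t)" by (auto simp: inj_def)
  define f where "f = Poly_Mapping.map_key (\<lambda>w. w + t) g"
  have f: "Poly_Mapping.lookup f w = Poly_Mapping.lookup g (w + t)" for w
    unfolding f_def by (simp add: map_key.rep_eq[OF inj])
  have "f * xpow t = g"
  proof (rule poly_mapping_eqI)
    fix s
    show "Poly_Mapping.lookup (f * xpow t) s = Poly_Mapping.lookup g s"
    proof (cases "\<exists>w. s = w + t")
      case False
      then have "s \<notin> monomial_box t Z" by (auto simp: monomial_box_def add.commute)
      then have "Poly_Mapping.lookup g s = 0" using g by (simp add: monomial_span_iff)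
      then show ?thesis using False by (metis lookup_times_xpow_0)
    qed (auto simp: f)
  qed
  moreover have "f \<in> polys_in Z"
    unfolding polys_in_def
  proof clarify
    fix w i assume "w \<in> Poly_Mapping.keys f" "i \<in> Poly_Mapping.keys w"
    then have "w + t \<in> monomial_box t Z" using g f by (auto simp: in_keys_iff monomial_span_iff)
    then have "Poly_Mapping.keys w \<subseteq> Z" by (auto simp: monomial_box_def add.commute[of w])
    then show "i \<in> Z" using \<open>i \<in> Poly_Mapping.keys w\<close> by blast
  qed
  ultimately show "g \<in> (\<lambda>f. f * xpow t) ` polys_in Z" by blast
qed

lemma corner_in_monomial_box: "t \<in> monomial_box t Z"
  by (auto simp: monomial_box_def intro: exI[of _ 0])

section \<open>Monomial ideals and their quotients\<close>

lemma ideal_closed: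
  fixes I :: "('n, 'k::field) mpoly set"
  assumes "ideal I mpoly_ring"
  shows "0 \<in> I" "\<And>f g. f \<in> I \<Longrightarrow> g \<in> I \<Longrightarrow> f + g \<in> I" "\<And>f g. g \<in> I \<Longrightarrow> f * g \<in> I"
proof -
  interpret ideal I "mpoly_ring :: ('n, 'k) mpoly ring" by fact
  show "0 \<in> I" "\<And>f g. f \<in> I \<Longrightarrow> g \<in> I \<Longrightarrow> f + g \<in> I" "\<And>f g. g \<in> I \<Longrightarrow> f * g \<in> I"
    using additive_subgroup.zero_closed[OF additive_subgroup_axioms]
      additive_subgroup.a_closed[OF additive_subgroup_axioms] I_l_closed by auto
qed

lemma exponents_add:
  assumes "ideal I mpoly_ring" "t \<in> exponents I"
  shows "t + s \<in> exponents I"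
  using ideal_closed(3)[OF assms(1), of "xpow t" "xpow s"] assms(2)
  by (simp add: exponents_def mult_single add.commute)

lemma monomial_span_ideal:
  assumes "\<And>t s. t \<in> S \<Longrightarrow> t + s \<in> S"
  shows "ideal (monomial_span S :: ('n, 'k::field) mpoly set) mpoly_ring"
proof -
  let ?R = "mpoly_ring :: ('n, 'k) mpoly ring"
  interpret R: cring ?R by (rule cring_from_type_algebra)
  have neg: "\<ominus>\<^bsub>?R\<^esub> f = - f" for f
    by (rule R.minus_equality) auto
  have mult: "f * g \<in> monomial_span S" if "f \<in> monomial_span S" for f g :: "('n, 'k) mpoly"
    using keys_mult[of f g] that assms by (fastforce simp: monomial_span_def)
  show ?thesis
  proof (rule idealI)
    show "subgroup (monomial_span S) (add_monoid ?R)"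
    proof (intro R.add.subgroupI)
      have "0 \<in> (monomial_span S :: ('n, 'k) mpoly set)" by (simp add: monomial_span_iff)
      then show "(monomial_span S :: ('n, 'k) mpoly set) \<noteq> {}" by blast
    qed (use neg in \<open>auto simp: monomial_span_iff lookup_add a_inv_def[symmetric]\<close>)
  qed (use mult in \<open>auto simp: R.ring_axioms mult.commute\<close>)
qed

text \<open>
  The right-hand side is an ideal containing the generators, so it contains \<open>I\<close>; conversely a
  polynomial is the sum of its terms, which are multiples of monomials of \<open>I\<close>.
\<close>

lemma monomial_ideal_eq_span:
  fixes I :: "('n, 'k::field) mpoly set"
  assumes "monomial_ideal I"
  shows "I = monomial_span (exponents I)"
proof
  let ?R = "mpoly_ring :: ('n, 'k) mpoly ring"
  interpret R: cring ?R by (rule cring_from_type_algebra)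
  note I = ideal_monomial_ideal[OF assms]
  obtain G where G: "G \<subseteq> monomials" "I = Idl\<^bsub>?R\<^esub> G"
    using assms unfolding monomial_ideal_def by blast
  have "G \<subseteq> I" unfolding G(2) by (rule R.genideal_self) simp
  then have "G \<subseteq> monomial_span (exponents I)"
    using G(1) by (force simp: monomials_def monomial_span_def exponents_def)
  then show "I \<subseteq> monomial_span (exponents I)"
    unfolding G(2)
    by (intro R.genideal_minimal monomial_span_ideal) (use exponents_add[OF I] in \<open>simp_all add: G(2)\<close>)
  show "monomial_span (exponents I) \<subseteq> I"
  proof
    fix f :: "('n, 'k) mpoly" assume f: "f \<in> monomial_span (exponents I)"
    have sum: "(\<Sum>t \<in> T. h t) \<in> I" if "finite T" "\<And>t. t \<in> T \<Longrightarrow> h t \<in> I" for T and h :: "_ \<Rightarrow> ('n, 'k) mpoly"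
      using that by (induction T) (auto intro: ideal_closed[OF I])
    show "f \<in> I"
      by (subst mpoly_eq_sum, rule sum)
        (use f in \<open>auto simp: monomial_span_def exponents_def intro: ideal_closed[OF I]\<close>)
  qed
qed

lemma in_monomial_ideal_iff:
  assumes "monomial_ideal I"
  shows "f \<in> I \<longleftrightarrow> (\<forall>t. t \<notin> exponents I \<longrightarrow> Poly_Mapping.lookup f t = 0)"
  by (subst monomial_ideal_eq_span[OF assms]) (rule monomial_span_iff)

text \<open>
  All of the module structure of \<open>S/I\<close> in terms of representatives.
\<close>

lemma cosets:
  fixes I :: "('n, 'k::field) mpoly set"
  assumes "ideal I mpoly_ring"
  defines "C \<equiv> \<lambda>f. I +>\<^bsub>mpoly_ring\<^esub> f" and "M \<equiv> quotient_module I"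
  shows "carrier M = range C" "C 0 = \<zero>\<^bsub>M\<^esub>" "C (f + g) = C f \<oplus>\<^bsub>M\<^esub> C g" "f \<odot>\<^bsub>M\<^esub> C g = C (f * g)"
    "C f = C g \<longleftrightarrow> f - g \<in> I"
proof -
  let ?R = "mpoly_ring :: ('n, 'k) mpoly ring"
  interpret ideal I ?R by fact
  interpret S: cring ?R by (rule cring_from_type_algebra)
  interpret h: ring_hom_ring ?R "?R Quot I" "(+>\<^bsub>?R\<^esub>) I"
    by (rule rcos_ring_hom_ring)
  have neg: "\<ominus>\<^bsub>?R\<^esub> f = - f" for f
    by (rule minus_equality) auto
  show "carrier M = range C"
    by (auto simp: M_def C_def quotient_module_def Let_def FactRing_def A_RCOSETS_def' image_def)
  show "C 0 = \<zero>\<^bsub>M\<^esub>"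
    using h.hom_zero by (simp add: M_def C_def quotient_module_def Let_def)
  show "C (f + g) = C f \<oplus>\<^bsub>M\<^esub> C g"
    using h.hom_add[of f g] by (simp add: M_def C_def quotient_module_def Let_def)
  show "f \<odot>\<^bsub>M\<^esub> C g = C (f * g)"
    using h.hom_mult[of f g] by (simp add: M_def C_def quotient_module_def Let_def)
  show "C f = C g \<longleftrightarrow> f - g \<in> I"
    using quotient_eq_iff_same_a_r_cos[OF assms(1), of f g]
    by (simp add: C_def a_minus_def neg)
qed

section \<open>Stanley decompositions of the quotient\<close>

lemma (in module) finsum_supported_on_singleton:
  assumes "m \<in> carrier M" "range c \<subseteq> carrier R" "{b. c b \<noteq> \<zero>} \<subseteq> {m}"
  shows "(\<Oplus>\<^bsub>M\<^esub>b \<in> {b. c b \<noteq> \<zero>}. c b \<odot>\<^bsub>M\<^esub> b) = c m \<odot>\<^bsub>M\<^esub> m"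
proof (cases "c m = \<zero>")
  case True
  then have "{b. c b \<noteq> \<zero>} = {}" using assms(3) by auto
  then show ?thesis using True assms by simp
next
  case False
  then have "{b. c b \<noteq> \<zero>} = {m}" using assms(3) by auto
  moreover have "c m \<in> carrier R" using assms(2) by auto
  ultimately show ?thesis using assms(1) by (simp add: M.finsum_insert)
qed

lemma polys_in_0_1: "0 \<in> polys_in Z" "1 \<in> polys_in Z"
  by (auto simp: polys_in_def)

lemma ex1_unique: "\<exists>!x. P x \<Longrightarrow> P a \<Longrightarrow> P b \<Longrightarrow> a = b"
  by blast

text \<open>
  If \<open>h\<close> kills the generator, then it kills every element of the cyclic module, in particular an
  element \<open>b\<close> of a basis. Then \<open>h b\<close> is a second expression of zero, besides the empty one.
  A basis element exists because the generator is not zero.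
\<close>

lemma free_cyclic_torsion_free:
  fixes M :: "(('n, 'k::field) mpoly, 'm) module"
  assumes M: "module mpoly_ring M" and m: "m \<in> carrier M" "m \<noteq> \<zero>\<^bsub>M\<^esub>"
    and free: "free_over (polys_in Z) M (cyclic_submodule M m Z)"
    and h: "h \<in> polys_in Z" "h \<odot>\<^bsub>M\<^esub> m = \<zero>\<^bsub>M\<^esub>"
  shows "h = 0"
proof (rule ccontr)
  assume "h \<noteq> 0"
  interpret M: module "mpoly_ring :: ('n, 'k) mpoly ring" M by fact
  note single = M.finsum_supported_on_singleton[simplified]
  let ?N = "cyclic_submodule M m Z"
  let ?P = "\<lambda>B x c. range c \<subseteq> polys_in Z \<and> finite {b. c b \<noteq> 0} \<and> {b. c b \<noteq> 0} \<subseteq> B \<and>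
     x = (\<Oplus>\<^bsub>M\<^esub>b \<in> {b. c b \<noteq> 0}. c b \<odot>\<^bsub>M\<^esub> b)"
  obtain B where B: "B \<subseteq> ?N" and ex: "\<forall>x \<in> ?N. \<exists>!c. ?P B x c"
    using free unfolding free_over_def by (elim exE conjE) (rule that)
  have "0 \<odot>\<^bsub>M\<^esub> m \<in> ?N" "1 \<odot>\<^bsub>M\<^esub> m \<in> ?N"
    unfolding cyclic_submodule_def using polys_in_0_1[of Z] by auto
  then have N: "\<zero>\<^bsub>M\<^esub> \<in> ?N" "m \<in> ?N"
    using M.smult_l_null[OF m(1)] M.smult_one[OF m(1)] by simp_all
  have "B \<noteq> {}"
  proof
    assume "B = {}"
    then have "\<exists>c. ?P {} m c" using bspec[OF ex N(2)] by (intro ex1_implies_ex) simp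
    then obtain c :: "'m \<Rightarrow> ('n, 'k) mpoly" where "{b. c b \<noteq> 0} = {}"
      "m = (\<Oplus>\<^bsub>M\<^esub>b \<in> {b. c b \<noteq> 0}. c b \<odot>\<^bsub>M\<^esub> b)"
      by auto
    then show False using m(2) by simp
  qed
  then obtain b where b: "b \<in> B" by blast
  then obtain f where f: "b = f \<odot>\<^bsub>M\<^esub> m" using B by (auto simp: cyclic_submodule_def)
  have bM: "b \<in> carrier M" using M.smult_closed[of f m] m(1) by (simp add: f)
  have "h \<odot>\<^bsub>M\<^esub> b = f \<odot>\<^bsub>M\<^esub> (h \<odot>\<^bsub>M\<^esub> m)"
    using M.smult_assoc1[of h f m] M.smult_assoc1[of f h m] m(1) by (simp add: f mult.commute)
  then have hb: "h \<odot>\<^bsub>M\<^esub> b = \<zero>\<^bsub>M\<^esub>" using h(2) M.smult_r_null[of f] by simp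
  \<comment> \<open>The expression \<open>h b\<close> of zero, as a family of coefficients.\<close>
  let ?c = "\<lambda>x. if x = b then h else 0"
  have "?P B \<zero>\<^bsub>M\<^esub> ?c"
  proof (intro conjI)
    show "finite {x. ?c x \<noteq> 0}" by (rule finite_subset[of _ "{b}"]) auto
    show "\<zero>\<^bsub>M\<^esub> = (\<Oplus>\<^bsub>M\<^esub>x \<in> {x. ?c x \<noteq> 0}. ?c x \<odot>\<^bsub>M\<^esub> x)"
      by (subst single[OF bM]) (auto simp: hb)
  qed (use b h(1) polys_in_0_1 in auto)
  moreover have "?P B \<zero>\<^bsub>M\<^esub> (\<lambda>_. 0)"
    using polys_in_0_1 by auto
  ultimately have "?c = (\<lambda>_. 0)"
    by (rule ex1_unique[OF bspec[OF ex N(1)]])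
  from fun_cong[OF this, of b] show False using \<open>h \<noteq> 0\<close> by simp
qed

lemma (in abelian_monoid) finsum_hom:
  fixes \<psi> :: "'p::comm_monoid_add \<Rightarrow> 'a"
  assumes "0 \<in> A" "\<And>f g. f \<in> A \<Longrightarrow> g \<in> A \<Longrightarrow> f + g \<in> A" "\<psi> 0 = \<zero>"
    "\<And>f g. f \<in> A \<Longrightarrow> g \<in> A \<Longrightarrow> \<psi> (f + g) = \<psi> f \<oplus> \<psi> g" "\<psi> ` A \<subseteq> carrier G"
    "finite J" "\<And>j. j \<in> J \<Longrightarrow> h j \<in> A"
  shows "(\<Oplus>j \<in> J. \<psi> (h j)) = \<psi> (\<Sum>j \<in> J. h j)"
  using assms(6,7)
proof (induction J)
  case empty
  then show ?case using assms(3) by simp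
next
  case (insert j J)
  have "(\<Sum>j \<in> J. h j) \<in> A"
    using \<open>finite J\<close> insert.prems by (induction J) (auto intro: assms)
  then show ?case
    using insert assms(5) by (subst finsum_insert) (auto simp: assms(4))
qed

text \<open>
  Some summand \<open>mK[Z]\<close> contributes to the coefficient of \<open>x\<^sup>t\<close>. There \<open>m\<close> is the class of \<open>c x\<^sup>d\<close>
  with \<open>c \<noteq> 0\<close>, and \<open>t = w + d\<close> for some \<open>w\<close> in \<open>\<nat>\<^sup>Z\<close>. If \<open>x\<^bsup>t + v\<^esup>\<close> were in \<open>I\<close> for some \<open>v\<close> in \<open>\<nat>\<^sup>Z\<close>,
  then \<open>x\<^bsup>w + v\<^esup>\<close> would kill \<open>m\<close>, which is impossible in a free module over \<open>K[Z]\<close>.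
\<close>

lemma stanley_quotient_box:
  fixes I :: "('n, 'k::field) mpoly set"
  assumes mI: "monomial_ideal I"
    and D: "stanley_decomposition (quotient_module I) (quotient_grading I) D"
    and t: "t \<notin> exponents I"
  shows "\<exists>(m, Z) \<in> set D. monomial_box t Z \<inter> exponents I = {}"
proof -
  let ?R = "mpoly_ring :: ('n, 'k) mpoly ring"
  define M where "M = quotient_module I"
  define C where "C f = I +>\<^bsub>?R\<^esub> f" for f
  note I = ideal_monomial_ideal[OF mI]
  note C = cosets[OF I, folded C_def M_def]
  interpret M: module ?R M unfolding M_def by (rule module_quotient_module[OF I])
  have in_I: "f \<in> I \<longleftrightarrow> (\<forall>s. s \<notin> exponents I \<longrightarrow> Poly_Mapping.lookup f s = 0)" for f
    by (rule in_monomial_ideal_iff[OF mI])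
  have sp: "stanley_space M (quotient_grading I) (fst (D ! j)) (snd (D ! j))" if "j < length D" for j
    using D nth_mem[OF that] unfolding stanley_decomposition_def M_def case_prod_beta by blast
  have "C (xpow t) \<in> carrier M" using C(1) by simp
  then obtain y where y: "y \<in> (\<Pi>\<^sub>E j \<in> {..<length D}. cyclic_submodule M (fst (D ! j)) (snd (D ! j)))"
    "C (xpow t) = (\<Oplus>\<^bsub>M\<^esub>j \<in> {..<length D}. y j)"
    using D unfolding stanley_decomposition_def M_def by blast
  have "\<forall>j\<in>{..<length D}. \<exists>f g a. f \<in> polys_in (snd (D ! j)) \<and> g \<in> homogeneous_polys a \<and>
      fst (D ! j) = C g \<and> y j = C (f * g)"
  proof
    fix j assume j: "j \<in> {..<length D}"
    then obtain a g where g: "g \<in> homogeneous_polys a" "fst (D ! j) = C g"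
      using sp[of j] by (auto simp: stanley_space_def quotient_grading_def C_def)
    obtain f where "f \<in> polys_in (snd (D ! j))" "y j = f \<odot>\<^bsub>M\<^esub> fst (D ! j)"
      using PiE_mem[OF y(1) j] by (auto simp: cyclic_submodule_def)
    then show "\<exists>f g a. f \<in> polys_in (snd (D ! j)) \<and> g \<in> homogeneous_polys a \<and>
      fst (D ! j) = C g \<and> y j = C (f * g)" using g C(4)[of f g] by metis
  qed
  then obtain f g a where fg: "\<And>j. j < length D \<Longrightarrow> f j \<in> polys_in (snd (D ! j))"
    "\<And>j. j < length D \<Longrightarrow> g j \<in> homogeneous_polys (a j)"
    "\<And>j. j < length D \<Longrightarrow> fst (D ! j) = C (g j)" "\<And>j. j < length D \<Longrightarrow> y j = C (f j * g j)"
    by (simp add: Ball_def) metis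
  have "C (xpow t) = (\<Oplus>\<^bsub>M\<^esub>j \<in> {..<length D}. C (f j * g j))"
    unfolding y(2) using fg(4) C(1) by (intro M.M.finsum_cong') auto
  also have "\<dots> = C (\<Sum>j<length D. f j * g j)"
    using C by (intro M.M.finsum_hom[of UNIV]) auto
  finally have "xpow t - (\<Sum>j<length D. f j * g j) \<in> I" using C(5) by blast
  then have "Poly_Mapping.lookup (xpow t - (\<Sum>j<length D. f j * g j)) t = 0"
    using t in_I by blast
  then have "(\<Sum>j<length D. Poly_Mapping.lookup (f j * g j) t) = 1"
    by (simp add: lookup_minus lookup_sum)
  then obtain j where j: "j < length D" "Poly_Mapping.lookup (f j * g j) t \<noteq> 0"
    using sum.neutral[of "{..<length D}" "\<lambda>j. Poly_Mapping.lookup (f j * g j) t"] by fastforce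
  then obtain w d where wd: "t = w + d" "w \<in> Poly_Mapping.keys (f j)" "d \<in> Poly_Mapping.keys (g j)"
    using keys_mult[of "f j" "g j"] by (auto simp: in_keys_iff)
  define Z where "Z = snd (D ! j)"
  have keys_g: "Poly_Mapping.keys (g j) \<subseteq> {d}"
  proof
    fix s assume "s \<in> Poly_Mapping.keys (g j)"
    then have "int (Poly_Mapping.lookup s i) = int (Poly_Mapping.lookup d i)" for i
      using fg(2)[OF j(1)] wd(3) by (simp add: homogeneous_polys_def)
    then show "s \<in> {d}" by (simp add: poly_mapping_eqI)
  qed
  have wZ: "Poly_Mapping.keys w \<subseteq> Z" using fg(1)[OF j(1)] wd(2) by (auto simp: polys_in_def Z_def)
  have "C (g j) \<noteq> \<zero>\<^bsub>M\<^esub>"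
  proof
    assume "C (g j) = \<zero>\<^bsub>M\<^esub>"
    then have "g j \<in> I" using C(5)[of "g j" 0] C(2) by simp
    then have "d \<in> exponents I" using wd(3) in_I by (auto simp: in_keys_iff)
    then show False using exponents_add[OF I, of d w] t wd(1) by (simp add: add.commute)
  qed
  have "monomial_box t Z \<inter> exponents I = {}"
  proof (rule ccontr)
    assume "monomial_box t Z \<inter> exponents I \<noteq> {}"
    then obtain v where v: "t + v \<in> exponents I" "Poly_Mapping.keys v \<subseteq> Z" by (auto simp: monomial_box_def)
    let ?h = "xpow (w + v) :: ('n, 'k) mpoly"
    have "Poly_Mapping.keys (?h * g j) \<subseteq> {t + v}"
    proof
      fix s assume "s \<in> Poly_Mapping.keys (?h * g j)"
      then obtain a b where "s = a + b" "a \<in> Poly_Mapping.keys ?h" "b \<in> Poly_Mapping.keys (g j)"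
        using keys_mult[of ?h "g j"] by blast
      moreover have "a = w + v" using calculation(2) by simp
      moreover have "b = d" using calculation(3) keys_g by blast
      ultimately show "s \<in> {t + v}" by (simp add: wd(1) ac_simps)
    qed
    then have "\<forall>s. s \<notin> exponents I \<longrightarrow> Poly_Mapping.lookup (?h * g j) s = 0" using v(1) by (metis in_keys_iff singletonD subsetD)
    then have "?h * g j \<in> I" using in_I by blast
    then have hC: "?h \<odot>\<^bsub>M\<^esub> C (g j) = \<zero>\<^bsub>M\<^esub>" using C(5)[of "?h * g j" 0] by (simp add: C(2,4))
    have hZ: "?h \<in> polys_in Z"
      using wZ v(2) keys_add[of w v] by (auto simp: polys_in_def)
    have free: "free_over (polys_in Z) M (cyclic_submodule M (C (g j)) Z)" "C (g j) \<in> carrier M"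
      using sp[OF j(1)] fg(3)[OF j(1)] by (auto simp: stanley_space_def Z_def)
    have "?h = 0"
      using free_cyclic_torsion_free[OF M.module_axioms free(2) \<open>C (g j) \<noteq> \<zero>\<^bsub>M\<^esub>\<close> free(1) hZ hC] .
    then show False by (metis lookup_single_eq lookup_zero zero_neq_one)
  qed
  then show ?thesis
    using nth_mem[OF j(1)] by (intro bexI[of _ "D ! j"]) (simp_all add: Z_def case_prod_beta)
qed

section \<open>Stanley decompositions from partitions into boxes\<close>

text \<open>
  A module that has the monomials with exponents in \<open>S\<close> as a basis, up to the identification
  \<open>\<psi>\<close>, with variables acting by multiplication as long as the result remains in the span of
  \<open>S\<close>. Both \<open>I\<close> and \<open>S/I\<close> have this form, which allows their Stanley decompositions to be
  constructed at the same time.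
\<close>

locale monomial_basis = module "mpoly_ring :: ('n, 'k::field) mpoly ring" M
  for M :: "(('n, 'k::field) mpoly, 'm) module" +
  fixes G :: "('n \<Rightarrow> int) \<Rightarrow> 'm set" and S :: "('n \<Rightarrow>\<^sub>0 nat) set" and \<psi> :: "('n, 'k::field) mpoly \<Rightarrow> 'm"
  assumes bij: "bij_betw \<psi> (monomial_span S) (carrier M)"
    and add: "\<And>f g. f \<in> monomial_span S \<Longrightarrow> g \<in> monomial_span S \<Longrightarrow> \<psi> (f + g) = \<psi> f \<oplus>\<^bsub>M\<^esub> \<psi> g"
    and smult: "\<And>f t. t \<in> S \<Longrightarrow> f * xpow t \<in> monomial_span S \<Longrightarrow> f \<odot>\<^bsub>M\<^esub> \<psi> (xpow t) = \<psi> (f * xpow t)"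
    and graded: "\<And>t. t \<in> S \<Longrightarrow> \<psi> (xpow t) \<in> G (\<lambda>i. int (Poly_Mapping.lookup t i))"
begin

lemma span_closed: "f \<in> monomial_span T \<Longrightarrow> g \<in> monomial_span T \<Longrightarrow> f + g \<in> monomial_span T"
  "0 \<in> monomial_span T" "t \<in> T \<Longrightarrow> xpow t \<in> monomial_span T"
  "T \<subseteq> U \<Longrightarrow> f \<in> monomial_span T \<Longrightarrow> f \<in> monomial_span U"
  by (auto simp: monomial_span_iff lookup_add lookup_single when_def)

lemma psi_closed: "f \<in> monomial_span S \<Longrightarrow> \<psi> f \<in> carrier M"
  using bij by (auto simp: bij_betw_def)

lemma psi_inj: "f \<in> monomial_span S \<Longrightarrow> g \<in> monomial_span S \<Longrightarrow> \<psi> f = \<psi> g \<Longrightarrow> f = g"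
  using bij by (auto simp: bij_betw_def inj_on_def)

lemma psi_0: "\<psi> 0 = \<zero>\<^bsub>M\<^esub>"
proof -
  have "\<psi> (0 + 0) = \<psi> 0 \<oplus>\<^bsub>M\<^esub> \<psi> 0" by (intro add span_closed(2))
  then show ?thesis
    using M.add.l_cancel_one'[OF psi_closed psi_closed, OF span_closed(2) span_closed(2)] by simp
qed

lemma psi_sum:
  assumes "finite J" "\<And>j. j \<in> J \<Longrightarrow> h j \<in> monomial_span S"
  shows "(\<Oplus>\<^bsub>M\<^esub>j \<in> J. \<psi> (h j)) = \<psi> (\<Sum>j \<in> J. h j)"
  using assms psi_closed by (intro M.finsum_hom[of "monomial_span S"]) (auto simp: span_closed psi_0 add)

lemma cyclic_submodule_xpow:
  assumes "monomial_box t Z \<subseteq> S"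
  shows "cyclic_submodule M (\<psi> (xpow t)) Z = \<psi> ` monomial_span (monomial_box t Z)"
proof -
  have t: "t \<in> S" using assms corner_in_monomial_box by blast
  have "f \<odot>\<^bsub>M\<^esub> \<psi> (xpow t) = \<psi> (f * xpow t)" if "f \<in> polys_in Z" for f
    using polys_in_times_xpow[of t Z] that assms by (intro smult t span_closed(4)[OF assms]) blast
  then show ?thesis
    unfolding cyclic_submodule_def polys_in_times_xpow[symmetric] image_image by (auto simp: image_def) metis
qed

lemma stanley_space_xpow:
  assumes "monomial_box t Z \<subseteq> S"
  shows "stanley_space M G (\<psi> (xpow t)) Z"
proof -
  let ?m = "\<psi> (xpow t)"
  have t: "t \<in> S" using assms corner_in_monomial_box by blast
  have m: "?m \<in> carrier M" using t by (intro psi_closed span_closed(3))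
  note single = finsum_supported_on_singleton[OF m, simplified]
  have span: "f * xpow t \<in> monomial_span S" if "f \<in> polys_in Z" for f
    using polys_in_times_xpow[of t Z] that assms by (intro span_closed(4)[OF assms]) blast
  have "\<exists>!c. range c \<subseteq> polys_in Z \<and> finite {b. c b \<noteq> 0} \<and> {b. c b \<noteq> 0} \<subseteq> {?m} \<and>
      x = (\<Oplus>\<^bsub>M\<^esub>b \<in> {b. c b \<noteq> 0}. c b \<odot>\<^bsub>M\<^esub> b)" (is "\<exists>!c. ?P c")
    if x: "x \<in> cyclic_submodule M ?m Z" for x
  proof -
    obtain f where f: "f \<in> polys_in Z" "x = f \<odot>\<^bsub>M\<^esub> ?m" using x by (auto simp: cyclic_submodule_def)
    show ?thesis
    proof (rule ex1I)
      let ?c = "\<lambda>b. if b = ?m then f else 0"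
      have "finite {b. ?c b \<noteq> 0}" by (rule finite_subset[of _ "{?m}"]) auto
      then show "?P ?c"
      proof (intro conjI)
        show "x = (\<Oplus>\<^bsub>M\<^esub>b \<in> {b. ?c b \<noteq> 0}. ?c b \<odot>\<^bsub>M\<^esub> b)"
          by (subst single) (auto simp: f)
      qed (use f polys_in_0_1 in auto)
    next
      fix c assume c: "?P c"
      then have "x = c ?m \<odot>\<^bsub>M\<^esub> ?m" using single[of c] by simp
      moreover have cm: "c ?m \<in> polys_in Z" using c by auto
      ultimately have "\<psi> (f * xpow t) = \<psi> (c ?m * xpow t)"
        using f(2) smult[OF t span[OF f(1)]] smult[OF t span[OF cm]] by metis
      then have "f * xpow t = c ?m * xpow t" by (rule psi_inj[OF span[OF f(1)] span[OF cm]])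
      then have "f = c ?m" by (rule times_xpow_cancel)
      then show "c = (\<lambda>b. if b = ?m then f else 0)" using c by (auto simp: fun_eq_iff)
    qed
  qed
  moreover have "?m \<in> cyclic_submodule M ?m Z"
    using smult_one[OF m] polys_in_0_1(2) by (force simp: cyclic_submodule_def)
  ultimately have "free_over (polys_in Z) M (cyclic_submodule M ?m Z)"
    unfolding free_over_def by (intro exI[of _ "{?m}"]) auto
  then show ?thesis using m graded[OF t] by (auto simp: stanley_space_def)
qed

text \<open>
  In the direct sum condition, the summand of an element in a box is forced to be the
  part of the element with exponents in that box, since the boxes partition \<open>S\<close>.
\<close>

lemma stanley_decomposition_of_boxes:
  assumes "decomposes dim_box k S" "S \<noteq> {}"
  shows "\<exists>D. stanley_decomposition M G D \<and> k \<le> sdepth_decomposition D"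
proof -
  obtain F where F: "finite F" "disjoint F" "\<Union>F = S" "\<forall>Y \<in> F. \<exists>d \<ge> k. dim_box d Y"
    using assms(1) unfolding decomposes_def by blast
  obtain Ys where Ys: "set Ys = F" "distinct Ys" using finite_distinct_list[OF F(1)] by blast
  define n where "n = length Ys"
  have "\<forall>Y\<in>F. \<exists>t Z. Y = monomial_box t Z \<and> k \<le> card Z"
    using F(4) unfolding dim_box_def by blast
  then obtain t Z where tZ: "\<And>Y. Y \<in> F \<Longrightarrow> Y = monomial_box (t Y) (Z Y)" "\<And>Y. Y \<in> F \<Longrightarrow> k \<le> card (Z Y)"
    by metis
  define D where "D = map (\<lambda>Y. (\<psi> (xpow (t Y)), Z Y)) Ys"
  have sub: "Y \<subseteq> S" if "Y \<in> F" for Y using F(3) that by blast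
  have YF: "Ys ! j \<in> F" if "j < n" for j using Ys(1) that by (auto simp: n_def)
  have disj: "s \<in> Ys ! i \<Longrightarrow> s \<in> Ys ! j \<Longrightarrow> i = j" if "i < n" "j < n" for s i j
    using disjointD[OF F(2), of "Ys ! i" "Ys ! j"] YF that nth_eq_iff_index_eq[OF Ys(2), of i j]
    by (auto simp: n_def)
  have cyc: "cyclic_submodule M (fst (D ! j)) (snd (D ! j)) = \<psi> ` monomial_span (Ys ! j)" if "j < n" for j
    using that cyclic_submodule_xpow[of "t (Ys ! j)" "Z (Ys ! j)"] tZ(1)[OF YF[OF that]] sub[OF YF[OF that]]
    by (simp add: D_def n_def)
  have spans: "f \<in> monomial_span S" if "f \<in> monomial_span (Ys ! j)" "j < n" for f j
    using span_closed(4) sub[OF YF[OF that(2)]] that(1) by blast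
  have "\<exists>!y. y \<in> (\<Pi>\<^sub>E j \<in> {..<n}. \<psi> ` monomial_span (Ys ! j)) \<and> x = (\<Oplus>\<^bsub>M\<^esub>j \<in> {..<n}. y j)"
    if x: "x \<in> carrier M" for x
  proof -
    obtain f where f: "f \<in> monomial_span S" "x = \<psi> f" using bij x by (auto simp: bij_betw_def)
    have parts: "(\<Sum>j<n. monomial_part (Ys ! j) f) = f"
    proof (rule poly_mapping_eqI)
      fix s
      have eq: "Poly_Mapping.lookup (\<Sum>j<n. monomial_part (Ys ! j) f) s = (\<Sum>j<n. if s \<in> Ys ! j then Poly_Mapping.lookup f s else 0)"
        by (simp add: lookup_sum lookup_monomial_part)
      show "Poly_Mapping.lookup (\<Sum>j<n. monomial_part (Ys ! j) f) s = Poly_Mapping.lookup f s"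
      proof (cases "s \<in> S")
        case True
        then obtain i where i: "i < n" "s \<in> Ys ! i"
          unfolding F(3)[symmetric] Ys(1)[symmetric] n_def by (auto simp: in_set_conv_nth)
        have "(\<Sum>j<n. if s \<in> Ys ! j then Poly_Mapping.lookup f s else 0) = (\<Sum>j<n. if j = i then Poly_Mapping.lookup f s else 0)"
          using i disj by (intro sum.cong) auto
        then show ?thesis unfolding eq using i(1) by simp
      next
        case False
        then show ?thesis unfolding eq using f(1) by (auto simp: monomial_span_iff intro!: sum.neutral)
      qed
    qed
    have part: "monomial_part (Ys ! j) f \<in> monomial_span S" if "j < n" for j
      using spans monomial_part_in_span that by blast
    show ?thesis
    proof (rule ex1I)
      let ?y = "\<lambda>j\<in>{..<n}. \<psi> (monomial_part (Ys ! j) f)"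
      have "(\<Oplus>\<^bsub>M\<^esub>j \<in> {..<n}. ?y j) = (\<Oplus>\<^bsub>M\<^esub>j \<in> {..<n}. \<psi> (monomial_part (Ys ! j) f))"
        using part psi_closed by (intro M.finsum_cong') auto
      also have "\<dots> = x" using part by (subst psi_sum) (auto simp: parts f(2))
      finally show "?y \<in> (\<Pi>\<^sub>E j \<in> {..<n}. \<psi> ` monomial_span (Ys ! j)) \<and> x = (\<Oplus>\<^bsub>M\<^esub>j \<in> {..<n}. ?y j)"
        using monomial_part_in_span by auto
    next
      fix y assume y: "y \<in> (\<Pi>\<^sub>E j \<in> {..<n}. \<psi> ` monomial_span (Ys ! j)) \<and> x = (\<Oplus>\<^bsub>M\<^esub>j \<in> {..<n}. y j)"
      then have "\<forall>j\<in>{..<n}. \<exists>g. g \<in> monomial_span (Ys ! j) \<and> y j = \<psi> g" by (auto simp: PiE_iff)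
      then obtain g where g: "\<And>j. j < n \<Longrightarrow> g j \<in> monomial_span (Ys ! j)" "\<And>j. j < n \<Longrightarrow> y j = \<psi> (g j)"
        by (metis lessThan_iff)
      have gS: "g j \<in> monomial_span S" if "j < n" for j using g(1) spans that by blast
      have "x = (\<Oplus>\<^bsub>M\<^esub>j \<in> {..<n}. \<psi> (g j))"
        unfolding conjunct2[OF y] using g(2) gS psi_closed by (intro M.finsum_cong') auto
      also have "\<dots> = \<psi> (\<Sum>j<n. g j)" using gS by (intro psi_sum) auto
      finally have "\<psi> f = \<psi> (\<Sum>j<n. g j)" using f(2) by simp
      moreover have "(\<Sum>j<n. g j) \<in> monomial_span S"
        using gS by (auto simp: monomial_span_iff lookup_sum intro!: sum.neutral)
      ultimately have fg: "f = (\<Sum>j<n. g j)" using f(1) psi_inj by blast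
      have "g i = monomial_part (Ys ! i) f" if i: "i < n" for i
      proof (rule poly_mapping_eqI)
        fix s
        show "Poly_Mapping.lookup (g i) s = Poly_Mapping.lookup (monomial_part (Ys ! i) f) s"
        proof (cases "s \<in> Ys ! i")
          case True
          have "Poly_Mapping.lookup (g j) s = (if j = i then Poly_Mapping.lookup (g i) s else 0)" if "j < n" for j
            using g(1)[OF that] disj[OF that i] True by (auto simp: monomial_span_iff)
          then have "Poly_Mapping.lookup f s = (\<Sum>j<n. if j = i then Poly_Mapping.lookup (g i) s else 0)"
            unfolding fg lookup_sum by (intro sum.cong) auto
          then show ?thesis using True i by (simp add: lookup_monomial_part)
        next
          case False
          then show ?thesis using g(1)[OF i] by (simp add: lookup_monomial_part monomial_span_iff)
        qed
      qed
      then show "y = (\<lambda>j\<in>{..<n}. \<psi> (monomial_part (Ys ! j) f))"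
        using y g(2) by (auto simp: PiE_iff extensional_def fun_eq_iff)
    qed
  qed
  note direct = this
  have "\<exists>!y. y \<in> (\<Pi>\<^sub>E j \<in> {..<length D}. cyclic_submodule M (fst (D ! j)) (snd (D ! j))) \<and>
      x = (\<Oplus>\<^bsub>M\<^esub>j \<in> {..<length D}. y j)" if x: "x \<in> carrier M" for x
  proof -
    have "length D = n" by (simp add: D_def n_def)
    moreover have "(\<Pi>\<^sub>E j \<in> {..<n}. cyclic_submodule M (fst (D ! j)) (snd (D ! j)))
      = (\<Pi>\<^sub>E j \<in> {..<n}. \<psi> ` monomial_span (Ys ! j))" using cyc by (intro PiE_cong) auto
    ultimately show ?thesis using direct[OF x] by simp
  qed
  moreover have "stanley_space M G m W" if "(m, W) \<in> set D" for m W
    using that stanley_space_xpow tZ(1) sub Ys(1) by (auto simp: D_def)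
  ultimately have "stanley_decomposition M G D"
    unfolding stanley_decomposition_def by blast
  moreover have "k \<le> sdepth_decomposition D"
  proof -
    have "F \<noteq> {}" using assms(2) F(3) by auto
    then show ?thesis using F(1) tZ(2) Ys(1)
      by (auto simp: sdepth_decomposition_def D_def)
  qed
  ultimately show ?thesis by blast
qed

end

lemma monomial_basis_ideal:
  fixes I :: "('n, 'k::field) mpoly set"
  assumes "monomial_ideal I"
  shows "monomial_basis (ideal_module I) (ideal_grading I) (exponents I) (\<lambda>f. f)"
proof -
  note I = ideal_monomial_ideal[OF assms]
  interpret module mpoly_ring "ideal_module I" by (rule module_ideal_module[OF I])
  show ?thesis
  proof
    show "bij_betw (\<lambda>f. f) (monomial_span (exponents I)) (carrier (ideal_module I))"
      using monomial_ideal_eq_span[OF assms] by (simp add: ideal_module_def bij_betw_def)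
  qed (auto simp: ideal_module_def ideal_grading_def exponents_def homogeneous_polys_def)
qed

lemma monomial_basis_quotient:
  fixes I :: "('n, 'k::field) mpoly set"
  assumes mI: "monomial_ideal I"
  shows "monomial_basis (quotient_module I) (quotient_grading I) (- exponents I) (\<lambda>f. I +>\<^bsub>mpoly_ring\<^esub> f)"
proof -
  note I = ideal_monomial_ideal[OF mI]
  note C = cosets[OF I]
  interpret module mpoly_ring "quotient_module I" by (rule module_quotient_module[OF I])
  have in_I: "f \<in> I \<longleftrightarrow> (\<forall>s. s \<notin> exponents I \<longrightarrow> Poly_Mapping.lookup f s = 0)" for f
    by (rule in_monomial_ideal_iff[OF mI])
  show ?thesis
  proof
    show "bij_betw (\<lambda>f. I +>\<^bsub>mpoly_ring\<^esub> f) (monomial_span (- exponents I)) (carrier (quotient_module I))"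
    proof (rule bij_betwI')
      fix f g :: "('n, 'k) mpoly"
      assume fg: "f \<in> monomial_span (- exponents I)" "g \<in> monomial_span (- exponents I)"
      have "f = g" if "f - g \<in> I"
      proof (rule poly_mapping_eqI)
        fix s
        show "Poly_Mapping.lookup f s = Poly_Mapping.lookup g s"
          using that fg in_I[of "f - g"] by (cases "s \<in> exponents I") (auto simp: monomial_span_iff lookup_minus)
      qed
      then show "(I +>\<^bsub>mpoly_ring\<^esub> f = I +>\<^bsub>mpoly_ring\<^esub> g) = (f = g)"
        unfolding C(5) using ideal_closed(1)[OF I] by auto
    next
      fix f :: "('n, 'k) mpoly"
      show "I +>\<^bsub>mpoly_ring\<^esub> f \<in> carrier (quotient_module I)" by (simp add: C(1))
    next
      fix x assume "x \<in> carrier (quotient_module I)"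
      then obtain f where "x = I +>\<^bsub>mpoly_ring\<^esub> f" by (auto simp: C(1))
      also have "\<dots> = I +>\<^bsub>mpoly_ring\<^esub> monomial_part (- exponents I) f"
        unfolding C(5) in_I by (simp add: lookup_minus lookup_monomial_part)
      finally show "\<exists>f\<in>monomial_span (- exponents I). x = I +>\<^bsub>mpoly_ring\<^esub> f"
        using monomial_part_in_span by blast
    qed
    show "(I +>\<^bsub>mpoly_ring\<^esub> xpow t) \<in> quotient_grading I (\<lambda>i. int (Poly_Mapping.lookup t i))" for t :: "'n \<Rightarrow>\<^sub>0 nat"
      unfolding quotient_grading_def by (rule imageI) (auto simp: homogeneous_polys_def)
  qed (simp_all add: C(3,4))
qed

section \<open>Stanley depth as an attained maximum\<close>

lemma stanley_decomposition_nonempty: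
  assumes "stanley_decomposition M G D" "x \<in> carrier M" "x \<noteq> \<zero>\<^bsub>M\<^esub>" "abelian_monoid M"
  shows "D \<noteq> []"
proof
  assume "D = []"
  moreover obtain y where "x = (\<Oplus>\<^bsub>M\<^esub>j \<in> {..<length D}. y j)"
    using assms(1,2) unfolding stanley_decomposition_def by blast
  ultimately show False using assms(3) by (simp add: abelian_monoid.finsum_empty[OF assms(4)])
qed

lemma sdepth_decomposition_le: "(m, Z) \<in> set D \<Longrightarrow> sdepth_decomposition D \<le> card Z"
  unfolding sdepth_decomposition_def by (rule Min_le) force+

text \<open>
  Stanley depths of decompositions are bounded by the number of variables: a decomposition of a
  nonzero module has a summand. Thus as soon as a decomposition exists, the maximum is that of a
  finite nonempty set.
\<close>

lemma
  fixes M :: "(('n::finite, 'k::field) mpoly, 'm) module"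
  assumes M: "abelian_monoid M" "carrier M \<noteq> {\<zero>\<^bsub>M\<^esub>}" and D: "stanley_decomposition M G D"
  shows sdepth_ge: "sdepth_decomposition D \<le> sdepth M G"
    and sdepth_attained: "\<exists>D'. stanley_decomposition M G D' \<and> sdepth_decomposition D' = sdepth M G"
proof -
  let ?A = "sdepth_decomposition ` {D. stanley_decomposition M G D}"
  obtain x where x: "x \<in> carrier M" "x \<noteq> \<zero>\<^bsub>M\<^esub>"
    using M(2) abelian_monoid.zero_closed[OF M(1)] by blast
  have "?A \<subseteq> {..CARD('n)}"
  proof clarify
    fix D' assume D': "stanley_decomposition M G D'"
    then have "D' \<noteq> []" using stanley_decomposition_nonempty[OF D' x M(1)] by simp
    then have "(fst (hd D'), snd (hd D')) \<in> set D'" by simp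
    then have "sdepth_decomposition D' \<le> card (snd (hd D'))" by (rule sdepth_decomposition_le)
    also have "\<dots> \<le> CARD('n)" by (intro card_mono) auto
    finally show "sdepth_decomposition D' \<le> CARD('n)" .
  qed
  then have fin: "finite ?A" by (rule finite_subset) simp
  show "sdepth_decomposition D \<le> sdepth M G"
    unfolding sdepth_def using fin D by (intro Max_ge) auto
  have "Max ?A \<in> ?A" using fin D by (intro Max_in) auto
  then show "\<exists>D'. stanley_decomposition M G D' \<and> sdepth_decomposition D' = sdepth M G"
    unfolding sdepth_def by auto
qed

section \<open>Three variables\<close>

lemma monomial_box_iff:
  "s \<in> monomial_box t Z \<longleftrightarrow> (\<forall>l. Poly_Mapping.lookup t l \<le> Poly_Mapping.lookup s l \<and> (l \<in> Z \<or> Poly_Mapping.lookup s l = Poly_Mapping.lookup t l))"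
proof
  assume "s \<in> monomial_box t Z"
  then obtain w where "s = t + w" "Poly_Mapping.keys w \<subseteq> Z" by (auto simp: monomial_box_def)
  then show "\<forall>l. Poly_Mapping.lookup t l \<le> Poly_Mapping.lookup s l \<and> (l \<in> Z \<or> Poly_Mapping.lookup s l = Poly_Mapping.lookup t l)"
    by (auto simp: lookup_add in_keys_iff subset_iff)
next
  assume *: "\<forall>l. Poly_Mapping.lookup t l \<le> Poly_Mapping.lookup s l \<and> (l \<in> Z \<or> Poly_Mapping.lookup s l = Poly_Mapping.lookup t l)"
  have "s = t + (s - t)"
    by (rule poly_mapping_eqI) (use * in \<open>simp add: lookup_add lookup_minus\<close>)
  moreover have "Poly_Mapping.keys (s - t) \<subseteq> Z"
    using * by (auto simp: in_keys_iff lookup_minus)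
  ultimately show "s \<in> monomial_box t Z" unfolding monomial_box_def by blast
qed

lemma exponents_above:
  fixes E :: "('n \<Rightarrow>\<^sub>0 nat) set"
  assumes up: "\<And>t s. t \<in> E \<Longrightarrow> t + s \<in> E" and "t \<in> E" "\<And>l. Poly_Mapping.lookup t l \<le> Poly_Mapping.lookup s l"
  shows "s \<in> E"
proof -
  have "s \<in> monomial_box t UNIV" using assms(3) by (simp add: monomial_box_iff)
  then show ?thesis using up[OF assms(2)] by (auto simp: monomial_box_def)
qed

text \<open>
  Let \<open>t\<close> be the coordinatewise minimum of \<open>E\<close>. If some \<open>p\<close> above \<open>t\<close> were outside \<open>E\<close>, then one could
  increase all coordinates of \<open>p\<close> but one, say \<open>l\<close>, without entering \<open>E\<close>. But an element of
  \<open>E\<close> with minimal coordinate \<open>l\<close> lies below \<open>p\<close> in this coordinate, so it is reached from \<open>p\<close> by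
  increasing the others. For monomial ideals this is the fact that an ideal whose
  quotient has only associated primes of height at most one is principal.
\<close>

lemma upset_is_principal:
  fixes E :: "('n::finite \<Rightarrow>\<^sub>0 nat) set"
  assumes up: "\<And>t s. t \<in> E \<Longrightarrow> t + s \<in> E" and ne: "E \<noteq> {}"
    and esc: "\<And>t. t \<notin> E \<Longrightarrow> \<exists>Z. CARD('n) \<le> Suc (card Z) \<and> monomial_box t Z \<inter> E = {}"
  shows "\<exists>t. E = monomial_box t UNIV"
proof -
  define a where "a l = (LEAST c. \<exists>q \<in> E. Poly_Mapping.lookup q l = c)" for l
  define t where "t = Abs_poly_mapping a"
  have t: "Poly_Mapping.lookup t l = a l" for l
    unfolding t_def by simp
  have least: "a l \<le> Poly_Mapping.lookup q l" if "q \<in> E" for q l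
    unfolding a_def using that by (intro Least_le) auto
  have attained: "\<exists>q \<in> E. Poly_Mapping.lookup q l = a l" for l
  proof -
    obtain q where "q \<in> E" using ne by blast
    then show ?thesis
      unfolding a_def using LeastI[of "\<lambda>c. \<exists>q \<in> E. Poly_Mapping.lookup q l = c" "Poly_Mapping.lookup q l"] by blast
  qed
  have "p \<in> E" if p: "p \<in> monomial_box t UNIV" for p
  proof (rule ccontr)
    assume "p \<notin> E"
    then obtain Z where Z: "CARD('n) \<le> Suc (card Z)" "monomial_box p Z \<inter> E = {}"
      using esc by blast
    have "card (- Z) \<le> Suc 0" using Z(1) by (simp add: Compl_eq_Diff_UNIV card_Diff_subset)
    then have "\<forall>x \<in> - Z. \<forall>y \<in> - Z. x = y" using card_le_Suc0_iff_eq[of "- Z"] by simp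
    then obtain l where l: "- Z \<subseteq> {l}" by blast
    obtain q where q: "q \<in> E" "Poly_Mapping.lookup q l = a l" using attained by blast
    \<comment> \<open>\<open>p + w\<close> dominates \<open>q\<close>: coordinate \<open>l\<close> of \<open>p\<close> is large enough already.\<close>
    define w where "w = q - Poly_Mapping.single l (Poly_Mapping.lookup q l)"
    have w: "Poly_Mapping.lookup w i = (if i = l then 0 else Poly_Mapping.lookup q i)" for i
      by (simp add: w_def lookup_minus lookup_single when_def)
    have "p + w \<in> E"
    proof (rule exponents_above[OF up q(1)])
      show "Poly_Mapping.lookup q i \<le> Poly_Mapping.lookup (p + w) i" for i
        using p q(2) by (auto simp: lookup_add w monomial_box_iff t)
    qed
    moreover have "p + w \<in> monomial_box p Z"
      using l w by (auto simp: monomial_box_def in_keys_iff split: if_splits)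
    ultimately show False using Z(2) by blast
  qed
  moreover have "E \<subseteq> monomial_box t UNIV"
    using least by (auto simp: monomial_box_iff t)
  ultimately show ?thesis by blast
qed

lemma axis_box_bounds:
  assumes "axis_box d P"
  shows "\<exists>p w. P = {x. p \<le> x \<and> (w \<or> x = p)} \<and> d = of_bool w"
  using assms
proof cases
  case (point a)
  then show ?thesis by (intro exI[of _ a] exI[of _ False]) auto
next
  case (ray a)
  then show ?thesis by (intro exI[of _ a] exI[of _ True]) auto
qed

text \<open>
  The names \<open>i\<close>, \<open>j\<close>, \<open>k\<close> of the three variables identify exponent vectors with points of
  \<open>\<nat> \<times> (\<nat> \<times> \<nat>)\<close>, where slicing along the first coordinate makes sense.
\<close>

locale three_coordinates =
  fixes i j k :: "'n::finite"
  assumes UNIV_eq: "(UNIV :: 'n set) = {i, j, k}" and distinct: "i \<noteq> j" "i \<noteq> k" "j \<noteq> k"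
begin

lemma all_iff: "(\<forall>l. P l) \<longleftrightarrow> P i \<and> P j \<and> P k"
  using UNIV_eq by (metis UNIV_I insertE singletonD)

definition coords :: "('n \<Rightarrow>\<^sub>0 nat) \<Rightarrow> nat \<times> nat \<times> nat" where
  "coords t = (Poly_Mapping.lookup t i, Poly_Mapping.lookup t j, Poly_Mapping.lookup t k)"

definition expo :: "nat \<times> nat \<times> nat \<Rightarrow> ('n \<Rightarrow>\<^sub>0 nat)" where
  "expo = (\<lambda>(c, a, b). Poly_Mapping.single i c + Poly_Mapping.single j a + Poly_Mapping.single k b)"

lemma coords_expo [simp]: "coords (expo x) = x"
  using distinct by (cases x) (auto simp: coords_def expo_def lookup_add lookup_single)

lemma coords_inj: "coords s = coords t \<Longrightarrow> s = t"
  using all_iff[of "\<lambda>l. Poly_Mapping.lookup s l = Poly_Mapping.lookup t l"] by (auto simp: coords_def intro: poly_mapping_eqI)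

lemma expo_coords [simp]: "expo (coords t) = t"
  by (rule coords_inj) simp

lemma expo_image_iff: "t \<in> expo ` S \<longleftrightarrow> coords t \<in> S"
proof
  show "t \<in> expo ` S" if "coords t \<in> S"
    using imageI[OF that, of expo] by simp
qed auto

lemma decomposes_dim_box:
  assumes "decomposes (prod_box (prod_box axis_box)) d (expo -` E)"
  shows "decomposes dim_box d E"
proof -
  have box: "dim_box d (expo ` Y)" if Y: "prod_box (prod_box axis_box) d Y" for d Y
  proof -
    obtain d1 d2 d3 P Q R where *: "d = d1 + (d2 + d3)" "Y = P \<times> Q \<times> R"
      "axis_box d1 P" "axis_box d2 Q" "axis_box d3 R"
      using Y by (auto elim!: prod_box.cases)
    obtain p u where p: "P = {x. p \<le> x \<and> (u \<or> x = p)}" "d1 = of_bool u"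
      using axis_box_bounds[OF *(3)] by blast
    obtain q v where q: "Q = {x. q \<le> x \<and> (v \<or> x = q)}" "d2 = of_bool v"
      using axis_box_bounds[OF *(4)] by blast
    obtain r w where r: "R = {x. r \<le> x \<and> (w \<or> x = r)}" "d3 = of_bool w"
      using axis_box_bounds[OF *(5)] by blast
    define Z where "Z = (if u then {i} else {}) \<union> (if v then {j} else {}) \<union> (if w then {k} else {})"
    have Z: "i \<in> Z \<longleftrightarrow> u" "j \<in> Z \<longleftrightarrow> v" "k \<in> Z \<longleftrightarrow> w"
      using distinct by (auto simp: Z_def)
    have "coords (expo (p, q, r)) = (p, q, r)" by simp
    then have "s \<in> monomial_box (expo (p, q, r)) Z \<longleftrightarrow> s \<in> expo ` Y" for s
      unfolding monomial_box_iff all_iff expo_image_iff Z *(2) p q r by (auto simp: coords_def)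
    then have "expo ` Y = monomial_box (expo (p, q, r)) Z" by blast
    moreover have "card Z = d"
      using distinct by (simp add: Z_def *(1) p q r)
    ultimately show ?thesis unfolding dim_box_def by metis
  qed
  have "inj expo" by (metis coords_expo injI)
  then have "decomposes dim_box d (expo ` (expo -` E))"
    by (intro decomposes_map[OF assms]) (auto simp: box inj_on_def dest: injD)
  moreover have "expo ` (expo -` E) = E"
    by (auto simp: expo_image_iff)
  ultimately show ?thesis by simp
qed

lemma upset_vimage:
  fixes E :: "('n \<Rightarrow>\<^sub>0 nat) set"
  assumes up: "\<And>t s. t \<in> E \<Longrightarrow> t + s \<in> E"
  shows "upset (expo -` E)"
  unfolding upset_def
proof (intro ballI allI impI)
  fix x y assume x: "x \<in> expo -` E" and le: "x \<le> y"
  have "\<forall>l. Poly_Mapping.lookup (expo x) l \<le> Poly_Mapping.lookup (expo y) l"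
    unfolding all_iff using le coords_expo[of x] coords_expo[of y] by (cases x; cases y) (simp add: coords_def)
  then show "y \<in> expo -` E" using exponents_above[OF up, of "expo x"] x by auto
qed

lemma complement_decomposes:
  fixes E :: "('n \<Rightarrow>\<^sub>0 nat) set"
  assumes up: "\<And>t s. t \<in> E \<Longrightarrow> t + s \<in> E"
  shows "decomposes dim_box 0 (- E)"
proof (rule decomposes_dim_box)
  have "decomposes (prod_box (prod_box axis_box)) 0 (UNIV - expo -` E)"
    by (intro decomposes_space_diff upset_vimage up) (auto simp: upset_def)
  moreover have "UNIV - expo -` E = expo -` (- E)" by auto
  ultimately show "decomposes (prod_box (prod_box axis_box)) 0 (expo -` (- E))" by simp
qed

text \<open>
  The combinatorial core: boxes of dimension at least \<open>d\<close> that avoid \<open>E\<close>, one at each point outside, give a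
  partition of \<open>E\<close> into boxes of dimension at least \<open>d + 1\<close>. For \<open>d = 3\<close> the hypothesis fails, because the
  full orthant at any point meets \<open>E\<close>, and larger \<open>d\<close> exceed the number of variables; \<open>d = 2\<close> is the principal case; for \<open>d = 1\<close> the slices
  decompose into rays and for \<open>d = 0\<close> into arbitrary boxes.
\<close>

lemma upset_decomposes:
  fixes E :: "('n \<Rightarrow>\<^sub>0 nat) set"
  assumes up: "\<And>t s. t \<in> E \<Longrightarrow> t + s \<in> E" and ne: "E \<noteq> {}" "E \<noteq> UNIV"
    and esc: "\<And>t. t \<notin> E \<Longrightarrow> \<exists>Z. d \<le> card Z \<and> monomial_box t Z \<inter> E = {}"
  shows "decomposes dim_box (Suc d) E"
proof -
  have card: "CARD('n) = 3" using distinct by (simp add: UNIV_eq)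
  have "d \<noteq> 3"
  proof
    assume "d = 3"
    obtain t where "t \<notin> E" using ne(2) by blast
    then obtain Z :: "'n set" where Z: "3 \<le> card Z" "monomial_box t Z \<inter> E = {}" using esc \<open>d = 3\<close> by blast
    then have "Z = UNIV" using card by (metis card_seteq finite subset_UNIV)
    obtain q where "q \<in> E" using ne(1) by blast
    then have "t + q \<in> E" using up[of q t] by (simp add: add.commute)
    moreover have "t + q \<in> monomial_box t Z" using \<open>Z = UNIV\<close> by (auto simp: monomial_box_def)
    ultimately show False using Z(2) by blast
  qed
  moreover have "d \<le> 3"
  proof -
    obtain t where "t \<notin> E" using ne(2) by blast
    then obtain Z :: "'n set" where "d \<le> card Z" using esc by blast
    also have "card Z \<le> CARD('n)" by (intro card_mono) auto
    finally show ?thesis using card by simp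
  qed
  ultimately consider "d = 0" | "d = 1" | "d = 2" by linarith
  then show ?thesis
  proof cases
    case 1
    then show ?thesis
      using decomposes_dim_box decomposes_space_upset_1[OF upset_vimage[OF up]] by simp
  next
    case 2
    have "decomposes (prod_box (prod_box axis_box)) 2 (expo -` E)"
    proof (rule decomposes_space_upset_2[OF upset_vimage[OF up]])
      fix c a b
      let ?t = "expo (c, a, b)"
      assume "(c, a, b) \<notin> expo -` E"
      then obtain Z where Z: "1 \<le> card Z" "monomial_box ?t Z \<inter> E = {}"
        using esc[of ?t] 2 by auto
      then obtain l where "l \<in> Z" by fastforce
      then have l: "i \<in> Z \<or> j \<in> Z \<or> k \<in> Z" using UNIV_eq by auto
      have out: "expo x \<notin> E" if "expo x \<in> monomial_box ?t Z" for x
        using that Z(2) by auto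
      have mem: "expo (c', a', b') \<in> monomial_box ?t Z \<longleftrightarrow>
        (c \<le> c' \<and> (i \<in> Z \<or> c' = c)) \<and> (a \<le> a' \<and> (j \<in> Z \<or> a' = a)) \<and> (b \<le> b' \<and> (k \<in> Z \<or> b' = b))" for c' a' b'
        unfolding monomial_box_iff all_iff using coords_expo[of "(c, a, b)"] coords_expo[of "(c', a', b')"]
        by (auto simp: coords_def)
      show "(\<forall>c'\<ge>c. (c', a, b) \<notin> expo -` E) \<or> (\<forall>a'\<ge>a. (c, a', b) \<notin> expo -` E) \<or> (\<forall>b'\<ge>b. (c, a, b') \<notin> expo -` E)"
        using l by (elim disjE) (simp_all add: out mem)
    qed
    then show ?thesis using 2 decomposes_dim_box by (simp add: numeral_2_eq_2)
  next
    case 3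
    have "\<exists>t. E = monomial_box t UNIV"
      using upset_is_principal[OF up ne(1)] esc card 3 by (metis Suc_le_mono numeral_2_eq_2 numeral_3_eq_3)
    then obtain t where "E = monomial_box t UNIV" by blast
    then have "dim_box 3 E" unfolding dim_box_def using card by metis
    then show ?thesis using 3 by (intro decomposes_box[of _ 3]) auto
  qed
qed

end

theorem theorem3:
  fixes I :: "(3, 'k::field) mpoly set"
  assumes "monomial_ideal I"
    and "I \<noteq> {0}"
    and "I \<noteq> UNIV"
  shows "sdepth (ideal_module I) (ideal_grading I)
       > sdepth (quotient_module I) (quotient_grading I)"
proof -
  have "card (UNIV :: 3 set) = 3" by simp
  then obtain i j k :: 3 where "UNIV = {i, j, k}" "i \<noteq> j" "i \<noteq> k" "j \<noteq> k"
    unfolding card_3_iff by metis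
  then interpret three_coordinates i j k by unfold_locales
  let ?E = "exponents I" and ?M = "ideal_module I" and ?Q = "quotient_module I"
  note I = ideal_monomial_ideal[OF assms(1)]
  note up = exponents_add[OF I]
  interpret M: monomial_basis ?M "ideal_grading I" ?E "\<lambda>f. f"
    by (rule monomial_basis_ideal[OF assms(1)])
  interpret Q: monomial_basis ?Q "quotient_grading I" "- ?E" "\<lambda>f. I +>\<^bsub>mpoly_ring\<^esub> f"
    by (rule monomial_basis_quotient[OF assms(1)])
  have ne: "?E \<noteq> {}"
  proof
    assume "?E = {}"
    then have "f = 0" if "f \<in> I" for f
      using that in_monomial_ideal_iff[OF assms(1), of f] by (auto intro: poly_mapping_eqI)
    then show False using ideal_closed(1)[OF I] assms(2) by blast
  qed
  have nu: "?E \<noteq> UNIV"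
    using in_monomial_ideal_iff[OF assms(1)] assms(3) by auto
  obtain t where t: "t \<notin> ?E" using nu by blast
  have "xpow t \<notin> I" using t by (simp add: exponents_def)
  then have "(I +>\<^bsub>mpoly_ring\<^esub> xpow t) \<noteq> \<zero>\<^bsub>?Q\<^esub>"
    using cosets(5)[OF I, of "xpow t" 0] cosets(2)[OF I] by simp
  then have nzQ: "carrier ?Q \<noteq> {\<zero>\<^bsub>?Q\<^esub>}" using cosets(1)[OF I] by blast
  have nzM: "carrier ?M \<noteq> {\<zero>\<^bsub>?M\<^esub>}" using assms(2) by (simp add: ideal_module_def)
  obtain D0 where "stanley_decomposition ?Q (quotient_grading I) D0"
    using Q.stanley_decomposition_of_boxes[OF complement_decomposes[OF up]] nu by blast
  then obtain D where D: "stanley_decomposition ?Q (quotient_grading I) D"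
    "sdepth_decomposition D = sdepth ?Q (quotient_grading I)"
    using sdepth_attained[OF Q.M.abelian_monoid_axioms nzQ] by blast
  \<comment> \<open>This is where an optimal decomposition of the quotient is used: all its \<open>Z\<close> are large.\<close>
  have "\<exists>Z. sdepth ?Q (quotient_grading I) \<le> card Z \<and> monomial_box s Z \<inter> ?E = {}" if s: "s \<notin> ?E" for s
  proof -
    obtain m Z where "(m, Z) \<in> set D" "monomial_box s Z \<inter> ?E = {}"
      using stanley_quotient_box[OF assms(1) D(1) s] by auto
    then show ?thesis using sdepth_decomposition_le D(2) by metis
  qed
  then have "decomposes dim_box (Suc (sdepth ?Q (quotient_grading I))) ?E"
    by (intro upset_decomposes up ne nu)
  then obtain D' where D': "stanley_decomposition ?M (ideal_grading I) D'"
    "Suc (sdepth ?Q (quotient_grading I)) \<le> sdepth_decomposition D'"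
    using M.stanley_decomposition_of_boxes ne by blast
  then show ?thesis
    using sdepth_ge[OF M.M.abelian_monoid_axioms nzM D'(1)] by simp
qed

end
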